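(* Let $(X,\tau)$ be a (real) Hausdorff locally convex space such that there is a metrizable locally convex topology $\rho$ on $X$ compatible with the duality, i.e. with $(X,\rho)^*=(X,\tau)^*$. Let $C$ be a nonempty closed convex bounded subset of $X$. The following assertions are equivalent: (1) Each nonempty closed convex subset of $C$ has the weak-AFPP. (2) Each sequence in $C$ has a weakly Cauchy subsequence.
   Context: Vector spaces are real. Topological notions without further specification refer to $\tau$; $X^*=(X,\tau)^*$ is the space of $\tau$-continuous linear functionals. A nonempty bounded closed convex set $D\subset X$ has the weak-AFPP (weak approximate fixed point property) if for every $\tau$-continuous mapping $f\colon D\to D$ there is a sequence $(x_n)$ in $D$ such that $x^*(x_n-f(x_n))\to 0$ for all $x^*\in X^*$. A sequence $(x_n)$ is weakly Cauchy if $(x^*(x_n))_n$ is a Cauchy sequence of reals for each $x^*\in X^*$. *)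

theory Defs
  imports "HOL-Analysis.Analysis"
begin

text \<open>
  The vector space is the whole type \<open>'a :: real_vector\<close>; it carries no type-class topology, and
  several topologies on it are considered, each given as a value of type \<open>'a topology\<close>.
  Hausdorffness is not part of the definition of a locally convex topology.
\<close>

definition locally_convex_topology :: "'a::real_vector topology \<Rightarrow> bool" where
  "locally_convex_topology T \<longleftrightarrow>
     topspace T = UNIV \<and>
     continuous_map (prod_topology T T) T (\<lambda>(x, y). x + y) \<and>
     continuous_map (prod_topology euclideanreal T) T (\<lambda>(r, x). r *\<^sub>R x) \<and>
     neighbourhood_base_at 0 convex T"

definition continuous_dual :: "'a::real_vector topology \<Rightarrow> ('a \<Rightarrow> real) set" where
  "continuous_dual T = {f. linear f \<and> continuous_map T euclideanreal f}"

text \<open>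
  Boundedness in the sense of topological vector spaces (absorption by every neighbourhood of 0),
  as opposed to the metric notion \<^const>\<open>bounded\<close>.  Since neighbourhoods are not required to be
  balanced, absorption is by all sufficiently large multiples.
\<close>

definition tvs_bounded :: "'a::real_vector topology \<Rightarrow> 'a set \<Rightarrow> bool" where
  "tvs_bounded T B \<longleftrightarrow>
     (\<forall>U. openin T U \<and> 0 \<in> U \<longrightarrow> (\<exists>s>0. \<forall>t>s. B \<subseteq> (\<lambda>x. t *\<^sub>R x) ` U))"

text \<open>The following is intended for nonempty, bounded, closed, convex \<open>D\<close>.\<close>

definition weak_AFPP :: "'a::real_vector topology \<Rightarrow> 'a set \<Rightarrow> bool" where
  "weak_AFPP T D \<longleftrightarrow>
     (\<forall>f. continuous_map (subtopology T D) (subtopology T D) f \<longrightarrow>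
        (\<exists>x :: nat \<Rightarrow> 'a. (\<forall>n. x n \<in> D) \<and>
           (\<forall>\<phi>\<in>continuous_dual T. (\<lambda>n. \<phi> (x n - f (x n))) \<longlonglongrightarrow> 0)))"

definition weakly_Cauchy :: "'a::real_vector topology \<Rightarrow> (nat \<Rightarrow> 'a) \<Rightarrow> bool" where
  "weakly_Cauchy T x \<longleftrightarrow> (\<forall>\<phi>\<in>continuous_dual T. Cauchy (\<lambda>n. \<phi> (x n)))"

end

theory Submission
  imports Defs
begin

text \<open>
  Metrizability of \<open>\<rho>\<close> makes the dual a countable union of pointwise compact polars.

  Let every sequence in \<open>C\<close> have a weakly Cauchy subsequence and let \<open>f\<close> be a continuous
  self-map of \<open>D\<close>. By Brouwer's theorem \<open>0\<close> is in the weak closure of \<open>{x - f x | x. x \<in> D}\<close>, and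
  compactness of the powers of the polars reduces this to a countable subset. A special case of the
  theorem of Bourgain, Fremlin and Talagrand then gives a sequence converging weakly to \<open>0\<close>:
  otherwise, a Ramsey argument along an ultrafilter that concentrates at \<open>0\<close> produces a
  sequence all of whose subsequences oscillate at some functional of a fixed polar.

  Conversely, let a sequence in \<open>C\<close> have no weakly Cauchy subsequence. Rosenthal's theorem, proved with the
  same Ramsey principle, yields a subsequence equivalent to the unit vector basis of \<open>\<ell>\<^sub>1\<close> for the
  seminorm of a polar. Its closed convex hull looks like the positive face of the unit sphere of \<open>\<ell>\<^sub>1\<close>;
  coordinatewise continuity suffices for maps on it, and a modified shift has no weak
  approximate fixed point sequence by a gliding hump argument.
\<close>

section \<open>Ultrafilters and a Ramsey principle\<close>

text \<open>The self-maps are only \<tau>-continuous and the dual need not be separable, so a weak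
  closure point of the displacements is not a limit for metric reasons. The Ramsey argument has to
  meet countably many conditions at once, which an ultrafilter does not grant; clustering sets do,
  through pseudo-intersections that still cluster at 0. In the converse direction X need not be
  complete, so series along the extracted sequence may fail to converge. Coordinates are therefore
  Hahn-Banach functionals, one for each set of indices, and the map is a locally finite sum. The
  plain shift would not do: it is affine, and averages along an orbit of an affine self-map of a
  bounded convex set are approximate fixed points. Applying the non-affine \<open>h\<close> to the
  tail masses rules out such spread-out averages.\<close>

locale free_ultrafilter =
  fixes U :: "nat set set"
  assumes mono: "M \<in> U \<Longrightarrow> M \<subseteq> N \<Longrightarrow> N \<in> U"
    and inter: "M \<in> U \<Longrightarrow> N \<in> U \<Longrightarrow> M \<inter> N \<in> U"
    and either: "M \<in> U \<or> - M \<in> U"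
    and infinite: "M \<in> U \<Longrightarrow> infinite M"

text \<open>A maximal family whose finite intersections satisfy \<open>P\<close> contains every set
  that can be adjoined to it (\<open>memI\<close>). If neither \<open>M\<close> nor
  \<open>- M\<close> could be adjoined, a finite intersection would split into two parts failing
  \<open>P\<close>.\<close>

lemma ultrafilter_of_partition_regular:
  fixes P :: "'i set \<Rightarrow> bool"
  assumes "P UNIV"
    and mono: "\<And>M N. P M \<Longrightarrow> M \<subseteq> N \<Longrightarrow> P N"
    and part: "\<And>M N. P (M \<union> N) \<Longrightarrow> P M \<or> P N"
  obtains U where "\<And>M. M \<in> U \<Longrightarrow> P M"
    "\<And>M N. M \<in> U \<Longrightarrow> M \<subseteq> N \<Longrightarrow> N \<in> U"
    "\<And>M N. M \<in> U \<Longrightarrow> N \<in> U \<Longrightarrow> M \<inter> N \<in> U"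
    "\<And>M. M \<in> U \<or> - M \<in> U"
proof -
  define \<A> where "\<A> = {F. \<forall>G. finite G \<and> G \<subseteq> F \<longrightarrow> P (\<Inter>G)}"
  have "\<exists>U\<in>\<A>. \<forall>X\<in>\<A>. U \<subseteq> X \<longrightarrow> X = U"
  proof (rule subset_Zorn')
    fix \<C> assume "subset.chain \<A> \<C>"
    then have sub: "\<C> \<subseteq> \<A>" and lin: "\<And>X Y. X \<in> \<C> \<Longrightarrow> Y \<in> \<C> \<Longrightarrow> X \<subseteq> Y \<or> Y \<subseteq> X"
      by (auto simp: subset_chain_def)
    have "P (\<Inter>G)" if G: "finite G" "G \<subseteq> \<Union>\<C>" for G
    proof (cases "\<C> = {}")
      case True
      then show ?thesis using G \<open>P UNIV\<close> by simp
    next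
      case False
      then obtain X where "X \<in> \<C>" "G \<subseteq> X"
        using finite_subset_Union_chain[OF G False \<open>subset.chain \<A> \<C>\<close>] by blast
      then show ?thesis using sub G by (auto simp: \<A>_def)
    qed
    then show "\<Union>\<C> \<in> \<A>" by (auto simp: \<A>_def)
  qed
  then obtain U where U: "U \<in> \<A>" and max: "\<And>X. X \<in> \<A> \<Longrightarrow> U \<subseteq> X \<Longrightarrow> X = U" by blast
  have memI: "S \<in> U" if fip: "\<And>G. finite G \<Longrightarrow> G \<subseteq> U \<Longrightarrow> P (\<Inter>G \<inter> S)" for S
  proof -
    have "P (\<Inter>G)" if "finite G" "G \<subseteq> insert S U" for G
    proof -
      have "P (\<Inter>(G - {S}) \<inter> S)" using that by (intro fip) auto
      then show ?thesis by (rule mono) auto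
    qed
    then have "insert S U \<in> \<A>" by (auto simp: \<A>_def)
    from max[OF this] show ?thesis by auto
  qed
  have fip: "P (\<Inter>G)" if "finite G" "G \<subseteq> U" for G using U that by (auto simp: \<A>_def)
  show thesis
  proof
    show "P M" if "M \<in> U" for M using fip[of "{M}"] that by auto
    show "N \<in> U" if "M \<in> U" "M \<subseteq> N" for M N
    proof (rule memI)
      fix G assume "finite G" "G \<subseteq> U"
      then have "P (\<Inter>(insert M G))" using that by (intro fip) auto
      then show "P (\<Inter>G \<inter> N)" by (rule mono) (use that in auto)
    qed
    show "M \<inter> N \<in> U" if "M \<in> U" "N \<in> U" for M N
    proof (rule memI)
      fix G assume "finite G" "G \<subseteq> U"
      then have "P (\<Inter>(insert M (insert N G)))" using that by (intro fip) auto
      then show "P (\<Inter>G \<inter> (M \<inter> N))" by (rule mono) auto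
    qed
    show "M \<in> U \<or> - M \<in> U" for M
    proof (rule ccontr)
      assume "\<not> ?thesis"
      then obtain G H where G: "finite G" "G \<subseteq> U" "\<not> P (\<Inter>G \<inter> M)"
        and H: "finite H" "H \<subseteq> U" "\<not> P (\<Inter>H \<inter> - M)"
        using memI[of M] memI[of "- M"] by blast
      have "P (\<Inter>(G \<union> H))" using G H by (intro fip) auto
      then have "P ((\<Inter>G \<inter> M) \<union> (\<Inter>H \<inter> - M))" by (rule mono) auto
      then show False using part G H by blast
    qed
  qed
qed

text \<open>Branching over sets of \<open>U\<close> replaces the Galvin-Prikry theorem for the closed set of sequences all of whose
  prefixes satisfy \<open>Q\<close>: if \<open>[]\<close> is barred, then every branch of some tree with \<open>U\<close>-large branching leaves
  \<open>Q\<close>; otherwise a diagonal sequence has all its subsequences in \<open>Q\<close>.\<close>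

inductive barred :: "(nat list \<Rightarrow> bool) \<Rightarrow> nat set set \<Rightarrow> nat list \<Rightarrow> bool"
  for Q :: "nat list \<Rightarrow> bool" and U :: "nat set set" where
  stop: "\<not> Q s \<Longrightarrow> barred Q U s"
| step: "N \<in> U \<Longrightarrow> (\<And>n. n \<in> N \<Longrightarrow> barred Q U (s @ [n])) \<Longrightarrow> barred Q U s"

text \<open>The implication makes this all of the naturals at barred lists, so it lies in
  \<open>U\<close> at every list and can be followed like a strategy.\<close>

definition free_set :: "(nat list \<Rightarrow> bool) \<Rightarrow> nat set set \<Rightarrow> nat list \<Rightarrow> nat set" where
  "free_set Q U s = {n. \<not> barred Q U s \<longrightarrow> \<not> barred Q U (s @ [n])}"

context free_ultrafilter
begin

lemma UNIV_mem: "UNIV \<in> U"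
  using either[of UNIV] infinite[of "{}"] by auto

lemma INT_mem: "finite I \<Longrightarrow> (\<And>i. i \<in> I \<Longrightarrow> S i \<in> U) \<Longrightarrow> (\<Inter>i\<in>I. S i) \<in> U"
  by (induction I rule: finite_induct) (auto intro: inter UNIV_mem)

lemma cofinite_mem: "finite (- M) \<Longrightarrow> M \<in> U"
  using either[of M] infinite by blast

lemma free_set_mem: "free_set Q U s \<in> U"
proof (rule ccontr)
  assume a: "free_set Q U s \<notin> U"
  then have "- free_set Q U s \<in> U" using either by blast
  then have "barred Q U s" by (rule barred.step) (auto simp: free_set_def)
  then have "free_set Q U s = UNIV" by (auto simp: free_set_def)
  then show False using a UNIV_mem by simp
qed

text \<open>Induction on the bar glues the strategies of the children. Obedience is asked only from
  position \<open>k\<close> on, because the prefix \<open>s\<close> has been played already.\<close>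

lemma barred_strategy:
  assumes "barred Q U s"
  shows "\<exists>S. (\<forall>t. S t \<in> U) \<and> (\<forall>\<mu> k. s = map \<mu> [0..<k] \<longrightarrow>
    (\<forall>j\<ge>k. \<mu> j \<in> S (map \<mu> [0..<j])) \<longrightarrow> (\<exists>j. \<not> Q (map \<mu> [0..<j])))"
  using assms
proof (induction rule: barred.induct)
  case (stop s)
  then show ?case by (intro exI[of _ "\<lambda>_. UNIV"]) (auto simp: UNIV_mem)
next
  case (step N s)
  then obtain S where S: "\<And>n t. n \<in> N \<Longrightarrow> S n t \<in> U"
    and leave: "\<And>n \<mu> k. n \<in> N \<Longrightarrow> s @ [n] = map \<mu> [0..<k] \<Longrightarrow>
      (\<And>j. j \<ge> k \<Longrightarrow> \<mu> j \<in> S n (map \<mu> [0..<j])) \<Longrightarrow> \<exists>j. \<not> Q (map \<mu> [0..<j])"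
    by metis
  \<comment> \<open>The entry of a longer list at position \<open>length s\<close> names the child
    whose strategy takes over; the remaining lists get the default \<open>UNIV\<close>.\<close>
  define S' where "S' t = (if t = s then N else if length t > length s \<and> t ! length s \<in> N
    then S (t ! length s) t else UNIV)" for t
  show ?case
  proof (intro exI[of _ S'] conjI allI impI)
    show "S' t \<in> U" for t using S step.hyps by (auto simp: S'_def UNIV_mem)
  next
    fix \<mu> k assume s: "s = map \<mu> [0..<k]" and \<mu>: "\<forall>j\<ge>k. \<mu> j \<in> S' (map \<mu> [0..<j])"
    have n: "\<mu> k \<in> N" using \<mu>[rule_format, of k] s by (simp add: S'_def)
    show "\<exists>j. \<not> Q (map \<mu> [0..<j])"
    proof (rule leave[OF n, of \<mu> "Suc k"])
      show "s @ [\<mu> k] = map \<mu> [0..<Suc k]" using s by simp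
      fix j assume j: "j \<ge> Suc k"
      have "map \<mu> [0..<j] \<noteq> s" using s j by (auto dest: arg_cong[of _ _ length])
      then show "\<mu> j \<in> S (\<mu> k) (map \<mu> [0..<j])"
        using \<mu>[rule_format, of j] j s n by (simp add: S'_def)
    qed
  qed
qed

text \<open>A prefix of any subsequence is a repetition-free list of earlier terms. There are
  finitely many of these, so each new term can be taken in all the corresponding sets at
  once.\<close>

lemma diagonal_sequence:
  fixes S :: "nat list \<Rightarrow> nat set"
  assumes S: "\<And>s. S s \<in> U"
  obtains \<nu> :: "nat \<Rightarrow> nat" where "strict_mono \<nu>"
    "\<And>r k. strict_mono r \<Longrightarrow> \<nu> (r k) \<in> S (map (\<nu> \<circ> r) [0..<k])"
proof -
  have ex: "\<exists>n. \<forall>s. distinct s \<and> set s \<subseteq> set l \<longrightarrow> n \<in> S s \<inter> {n. \<forall>y\<in>set l. y < n}" for l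
  proof -
    have fin: "finite {s. distinct s \<and> set s \<subseteq> set l}"
      using finite_subset_distinct[of "set l"] by (simp add: conj_commute)
    have "- {n. \<forall>y\<in>set l. y < n} = (\<Union>y\<in>set l. {..y})" by (auto simp: not_less)
    then have "finite (- {n. \<forall>y\<in>set l. y < n})" by simp
    then have "{n. \<forall>y\<in>set l. y < n} \<in> U" by (rule cofinite_mem)
    then have "(\<Inter>s\<in>{s. distinct s \<and> set s \<subseteq> set l}. S s \<inter> {n. \<forall>y\<in>set l. y < n}) \<in> U"
      using fin S by (intro INT_mem inter) auto
    from infinite[OF this] have "(\<Inter>s\<in>{s. distinct s \<and> set s \<subseteq> set l}. S s \<inter> {n. \<forall>y\<in>set l. y < n}) \<noteq> {}"
      by (metis finite.emptyI)
    then show ?thesis by blast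
  qed
  then obtain N where N: "\<And>l s. distinct s \<Longrightarrow> set s \<subseteq> set l \<Longrightarrow> N l \<in> S s"
    and less: "\<And>l y. y \<in> set l \<Longrightarrow> y < N l"
  proof -
    obtain N where N: "\<forall>l s. distinct s \<and> set s \<subseteq> set l \<longrightarrow> N l \<in> S s \<inter> {n. \<forall>y\<in>set l. y < n}"
      using ex by metis
    show thesis by (rule that[of N]) (use N in \<open>force dest: spec[of _ "[]"]\<close>)+
  qed
  define L where "L = rec_nat [] (\<lambda>_ l. l @ [N l])"
  define \<nu> where "\<nu> k = N (L k)" for k
  have L: "set (L k) = \<nu> ` {..<k}" for k
    by (induction k) (auto simp: L_def \<nu>_def lessThan_Suc)
  show thesis
  proof
    show sm: "strict_mono \<nu>"
      unfolding strict_mono_def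
    proof (intro allI impI)
      fix i j :: nat assume "i < j"
      then have "\<nu> i \<in> set (L j)" by (simp add: L)
      then show "\<nu> i < \<nu> j" unfolding \<nu>_def[of j] by (rule less)
    qed
    show "\<nu> (r k) \<in> S (map (\<nu> \<circ> r) [0..<k])" if "strict_mono r" for r k
      unfolding \<nu>_def[of "r k"]
    proof (rule N)
      have "inj (\<nu> \<circ> r)" using sm that by (meson strict_mono_o strict_mono_imp_inj_on)
      then show "distinct (map (\<nu> \<circ> r) [0..<k])" by (simp add: distinct_map inj_on_def)
      show "set (map (\<nu> \<circ> r) [0..<k]) \<subseteq> set (L (r k))"
        using that by (auto simp: L strict_mono_def)
    qed
  qed
qed

lemma unbarred_sequence:
  assumes "\<not> barred Q U []"
  obtains \<nu> :: "nat \<Rightarrow> nat" where "strict_mono \<nu>"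
    "\<And>r k. strict_mono r \<Longrightarrow> Q (map (\<nu> \<circ> r) [0..<k])"
proof -
  obtain \<nu> :: "nat \<Rightarrow> nat" where \<nu>: "strict_mono \<nu>"
    "\<And>r k. strict_mono r \<Longrightarrow> \<nu> (r k) \<in> free_set Q U (map (\<nu> \<circ> r) [0..<k])"
    by (rule diagonal_sequence[of "free_set Q U"]) (auto simp: free_set_mem)
  have "\<not> barred Q U (map (\<nu> \<circ> r) [0..<k])" if "strict_mono r" for r k
  proof (induction k)
    case (Suc k)
    then show ?case using \<nu>(2)[OF that, of k] by (simp add: free_set_def comp_def)
  qed (use assms in simp)
  then show thesis using \<nu>(1) that barred.stop by blast
qed

end

section \<open>Cluster points that are limits\<close>

lemma recursive_sequence:
  fixes c :: "'i list \<Rightarrow> 'i"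
  obtains \<mu> where "\<And>k. \<mu> k = c (map \<mu> [0..<k])"
proof -
  define L where "L = rec_nat [] (\<lambda>_ l. l @ [c l])"
  have L: "L k = map (\<lambda>k. c (L k)) [0..<k]" for k
    by (induction k) (simp_all add: L_def)
  show thesis by (rule that[of "\<lambda>k. c (L k)"]) (rule arg_cong[where f = c, OF L])
qed

lemma compact_closed_sequence:
  assumes "compact K" and Z: "\<And>i::nat. closed (Z i)" and ex: "\<And>k. \<exists>t\<in>K. \<forall>i<k. t \<in> Z i"
  shows "\<exists>t\<in>K. \<forall>i. t \<in> Z i"
proof -
  have "K \<inter> \<Inter>(Z ` UNIV) \<noteq> {}"
  proof (rule compact_imp_fip_image[OF \<open>compact K\<close>])
    fix I :: "nat set" assume "finite I"
    then obtain k where "I \<subseteq> {..<k}" by (metis finite_nat_bounded)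
    then show "K \<inter> \<Inter>(Z ` I) \<noteq> {}" using ex[of k] by blast
  qed (use Z in auto)
  then show ?thesis by auto
qed

text \<open>Membership of 0 in the closure of the functions \<open>G i\<close> for pointwise
  convergence on \<open>K\<close>, stated as a property of the index set because ultrafilters and
  strategies act on indices.\<close>

definition pointwise_clusters_0 :: "('i \<Rightarrow> 'k \<Rightarrow> real) \<Rightarrow> 'k set \<Rightarrow> 'i set \<Rightarrow> bool" where
  "pointwise_clusters_0 G K M \<longleftrightarrow>
     (\<forall>F e. finite F \<and> F \<subseteq> K \<and> e > 0 \<longrightarrow> (\<exists>i\<in>M. \<forall>t\<in>F. \<bar>G i t\<bar> < e))"

lemma pointwise_clusters_0D:
  "pointwise_clusters_0 G K M \<Longrightarrow> finite F \<Longrightarrow> F \<subseteq> K \<Longrightarrow> e > 0 \<Longrightarrow> \<exists>i\<in>M. \<forall>t\<in>F. \<bar>G i t\<bar> < e"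
  by (auto simp: pointwise_clusters_0_def)

lemma pointwise_clusters_0_mono:
  "pointwise_clusters_0 G K M \<Longrightarrow> M \<subseteq> N \<Longrightarrow> pointwise_clusters_0 G K N"
  unfolding pointwise_clusters_0_def by (metis subsetD)

lemma pointwise_clusters_0_Un:
  assumes "pointwise_clusters_0 G K (M \<union> N)"
  shows "pointwise_clusters_0 G K M \<or> pointwise_clusters_0 G K N"
proof (rule ccontr)
  assume "\<not> ?thesis"
  then obtain F e F' e' where F: "finite F" "F \<subseteq> K" "e > 0" "\<not> (\<exists>i\<in>M. \<forall>t\<in>F. \<bar>G i t\<bar> < e)"
    and F': "finite F'" "F' \<subseteq> K" "e' > 0" "\<not> (\<exists>i\<in>N. \<forall>t\<in>F'. \<bar>G i t\<bar> < e')"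
    unfolding pointwise_clusters_0_def by blast
  have "\<exists>i\<in>M \<union> N. \<forall>t\<in>F \<union> F'. \<bar>G i t\<bar> < min e e'"
    using F F' by (intro pointwise_clusters_0D[OF assms]) auto
  then show False using F F' by fastforce
qed

lemma compact_functions:
  fixes K :: "'i \<Rightarrow> 'k::topological_space set"
  assumes "\<And>j. compact (K j)"
  shows "compact {t. \<forall>j. t j \<in> K j}"
proof -
  have "compactin (product_topology (\<lambda>_. euclidean) UNIV) (PiE UNIV K)"
    using assms by (subst compactin_PiE) (auto simp: compactin_euclidean_iff)
  moreover have "PiE UNIV K = {t. \<forall>j. t j \<in> K j}" by (auto simp: PiE_UNIV_domain)
  ultimately show ?thesis
    by (simp add: euclidean_product_topology flip: compactin_euclidean_iff)
qed

text \<open>Finite tests in \<open>K k\<close> become points of its compact power, so finitely many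
  indices of \<open>M k\<close> pass all tests of at most \<open>Suc k\<close> points with tolerance
  \<open>1 / Suc k\<close>. The power is a full sequence space of which only the first
  \<open>Suc k\<close> coordinates are tested.\<close>

lemma countable_fan_tightness:
  fixes G :: "'i \<Rightarrow> 'k::topological_space \<Rightarrow> real" and K :: "nat \<Rightarrow> 'k set" and M :: "nat \<Rightarrow> 'i set"
  assumes comp: "\<And>k. compact (K k)" and inc: "incseq K" and K0: "K 0 \<noteq> {}"
    and cont: "\<And>i. continuous_on UNIV (G i)"
    and clus: "\<And>k. pointwise_clusters_0 G (\<Union>k. K k) (M k)"
  shows "\<exists>Fs :: nat \<Rightarrow> 'i set. (\<forall>k. finite (Fs k)) \<and> (\<forall>k. Fs k \<subseteq> M k) \<and>
    (\<forall>j. pointwise_clusters_0 G (\<Union>k. K k) (\<Union>k\<in>{j..}. Fs k))"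
proof -
  have ex: "\<exists>F. finite F \<and> F \<subseteq> M k \<and>
    {t. \<forall>j. t j \<in> K k} \<subseteq> (\<Union>i\<in>F. {t. \<forall>j\<in>{..<Suc k}. \<bar>G i (t j)\<bar> < 1 / Suc k})" for k
  proof -
    have "{t. \<forall>j\<in>{..<Suc k}. \<bar>G i (t j)\<bar> < 1 / Suc k} =
        (\<Inter>j\<in>{..<Suc k}. {t. \<bar>G i (t j)\<bar> < 1 / Suc k})" for i by auto
    moreover have "continuous_on UNIV (\<lambda>t. G i (t j))" for i and j :: nat
      using continuous_on_compose2[OF cont continuous_on_product_coordinates] by simp
    then have "open {t. \<bar>G i (t j)\<bar> < 1 / Suc k}" for i and j :: nat
      by (intro open_Collect_less continuous_intros)
    ultimately have op: "open {t. \<forall>j\<in>{..<Suc k}. \<bar>G i (t j)\<bar> < 1 / Suc k}" for i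
      by (metis (no_types, lifting) finite_lessThan open_INT)
    have cov: "{t. \<forall>j. t j \<in> K k} \<subseteq> (\<Union>i\<in>M k. {t. \<forall>j\<in>{..<Suc k}. \<bar>G i (t j)\<bar> < 1 / Suc k})"
    proof
      fix t :: "nat \<Rightarrow> 'k" assume t: "t \<in> {t. \<forall>j. t j \<in> K k}"
      then have "t ` {..<Suc k} \<subseteq> (\<Union>k. K k)" by auto
      from pointwise_clusters_0D[OF clus[of k] _ this, of "1 / Suc k"]
      show "t \<in> (\<Union>i\<in>M k. {t. \<forall>j\<in>{..<Suc k}. \<bar>G i (t j)\<bar> < 1 / Suc k})" by auto
    qed
    show ?thesis
      by (rule compactE_image[OF compact_functions[OF comp[of k]] op cov]) blast
  qed
  obtain Fs where fin: "\<And>k. finite (Fs k)" and sub: "\<And>k. Fs k \<subseteq> M k"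
    and cov: "\<And>k. {t. \<forall>j. t j \<in> K k} \<subseteq> (\<Union>i\<in>Fs k. {t. \<forall>j\<in>{..<Suc k}. \<bar>G i (t j)\<bar> < 1 / Suc k})"
  proof (rule that)
    show "finite (SOME F. finite F \<and> F \<subseteq> M k \<and> {t. \<forall>j. t j \<in> K k} \<subseteq> (\<Union>i\<in>F. {t. \<forall>j\<in>{..<Suc k}. \<bar>G i (t j)\<bar> < 1 / Suc k}))" for k
      using someI_ex[OF ex[of k]] by blast
  qed (use someI_ex[OF ex] in blast)+
  have "pointwise_clusters_0 G (\<Union>k. K k) (\<Union>k\<in>{j..}. Fs k)" for j
    unfolding pointwise_clusters_0_def
  proof (intro allI impI, elim conjE)
    fix F :: "'k set" and e :: real assume F: "finite F" "F \<subseteq> (\<Union>k. K k)" and "e > 0"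
    obtain t0 where t0: "t0 \<in> K 0" using K0 by auto
    have "\<exists>n. insert t0 F \<subseteq> K n"
    proof (rule finite_subset_Union_chain[of "insert t0 F" "range K" UNIV])
      show "subset.chain UNIV (range K)"
        using inc by (auto simp: subset_chain_def incseq_def) (metis nat_le_linear subsetD)
    qed (use F t0 in auto)
    then obtain n where n: "insert t0 F \<subseteq> K n" by blast
    obtain n' :: nat where n': "1 / Suc n' < e" using \<open>e > 0\<close> nat_approx_posE by blast
    \<comment> \<open>Large enough in four respects: beyond \<open>j\<close>, with
      \<open>K k\<close> containing the test points, precise enough, and with room to list them.
      Spare coordinates are padded by \<open>t0\<close>.\<close>
    define k where "k = Max {j, n, n', card (insert t0 F)}"
    have k: "j \<le> k" "n \<le> k" "n' \<le> k" "card (insert t0 F) \<le> k" by (auto simp: k_def)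
    have "insert t0 F \<subseteq> K k" using n inc k by (meson incseq_def order_trans)
    obtain f where f: "f ` {..<card (insert t0 F)} = insert t0 F"
      using ex_bij_betw_nat_finite[of "insert t0 F"] F(1)
      by (metis atLeast0LessThan bij_betw_imp_surj_on finite_insert)
    define t where "t j = (if j < card (insert t0 F) then f j else t0)" for j
    have "t \<in> {t. \<forall>j. t j \<in> K k}" using f \<open>insert t0 F \<subseteq> K k\<close> by (auto simp: t_def)
    with cov obtain i where i: "i \<in> Fs k" "\<forall>j\<in>{..<Suc k}. \<bar>G i (t j)\<bar> < 1 / Suc k" by blast
    have "\<bar>G i x\<bar> < e" if "x \<in> F" for x
    proof -
      have "x \<in> f ` {..<card (insert t0 F)}" unfolding f using that by simp
      then obtain j where j: "j < card (insert t0 F)" "f j = x" by auto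
      then have "\<bar>G i x\<bar> < 1 / Suc k" using bspec[OF i(2), of j] k(4) by (simp add: t_def)
      also have "\<dots> \<le> 1 / Suc n'" using k by (intro divide_left_mono) auto
      finally show ?thesis using n' by simp
    qed
    then show "\<exists>i\<in>\<Union>k\<in>{j..}. Fs k. \<forall>t\<in>F. \<bar>G i t\<bar> < e" using i(1) k(1) by blast
  qed
  then show ?thesis using fin sub by blast
qed

text \<open>The substitute for closure under countable intersections: only the finite sets chosen
  before stage \<open>k\<close> can stick out of \<open>M k\<close>.\<close>

lemma clustering_pseudo_intersection:
  fixes G :: "'i \<Rightarrow> 'k::topological_space \<Rightarrow> real" and K :: "nat \<Rightarrow> 'k set" and M :: "nat \<Rightarrow> 'i set"
  assumes "\<And>k. compact (K k)" "incseq K" "K 0 \<noteq> {}" "\<And>i. continuous_on UNIV (G i)"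
    and "\<And>k. pointwise_clusters_0 G (\<Union>k. K k) (M k)" and dec: "decseq M"
  obtains N where "pointwise_clusters_0 G (\<Union>k. K k) N" "\<And>k. finite (N - M k)"
proof -
  obtain Fs :: "nat \<Rightarrow> 'i set" where "(\<forall>k. finite (Fs k)) \<and> (\<forall>k. Fs k \<subseteq> M k) \<and>
    (\<forall>j. pointwise_clusters_0 G (\<Union>k. K k) (\<Union>k\<in>{j..}. Fs k))"
    using countable_fan_tightness[OF assms(1-5)] ..
  then have Fs: "\<And>k. finite (Fs k)" "\<And>k. Fs k \<subseteq> M k"
    "\<And>j. pointwise_clusters_0 G (\<Union>k. K k) (\<Union>k\<in>{j..}. Fs k)" by blast+
  show thesis
  proof
    show "pointwise_clusters_0 G (\<Union>k. K k) (\<Union>k. Fs k)" using Fs(3)[of 0] by simp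
    fix k
    have "(\<Union>k. Fs k) - M k \<subseteq> (\<Union>j\<in>{..<k}. Fs j)"
    proof
      fix i assume "i \<in> (\<Union>k. Fs k) - M k"
      then obtain j where "i \<in> Fs j" "i \<notin> M k" by auto
      moreover have "\<not> k \<le> j" using calculation Fs(2)[of j] dec by (auto simp: decseq_def)
      ultimately show "i \<in> (\<Union>j\<in>{..<k}. Fs j)" by auto
    qed
    then show "finite ((\<Union>k. Fs k) - M k)" by (rule finite_subset) (use Fs(1) in auto)
  qed
qed

text \<open>Oscillation is first located hereditarily in a single \<open>K m\<close>; then both
  outcomes of the Ramsey principle are refuted. A strategy is beaten by one point that oscillates
  along a clustering pseudo-intersection of its sets; an unbarred sequence contradicts
  \<open>cauchy\<close> by compactness of \<open>K m\<close>.\<close>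

theorem pointwise_cluster_point_is_limit:
  fixes G :: "nat \<Rightarrow> 'k::topological_space \<Rightarrow> real" and K :: "nat \<Rightarrow> 'k set"
  assumes comp: "\<And>k. compact (K k)" and inc: "incseq K" and K0: "K 0 \<noteq> {}"
    and cont: "\<And>n. continuous_on UNIV (G n)"
    and clus: "pointwise_clusters_0 G (\<Union>k. K k) UNIV"
    and cauchy: "\<And>s :: nat \<Rightarrow> nat. strict_mono s \<Longrightarrow>
      \<exists>r :: nat \<Rightarrow> nat. strict_mono r \<and> (\<forall>t\<in>\<Union>k. K k. Cauchy (\<lambda>k. G (s (r k)) t))"
  obtains \<nu> :: "nat \<Rightarrow> nat" where "\<And>t. t \<in> (\<Union>k. K k) \<Longrightarrow> (\<lambda>k. G (\<nu> k) t) \<longlonglongrightarrow> 0"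
proof (rule ccontr)
  assume "\<not> thesis"
  then have no: "\<exists>t\<in>\<Union>k. K k. \<not> (\<lambda>k. G (\<nu> k) t) \<longlonglongrightarrow> 0" for \<nu> :: "nat \<Rightarrow> nat"
    using that by blast
  let ?E = "pointwise_clusters_0 G (\<Union>k. K k)"
  note pseudo = clustering_pseudo_intersection[OF comp inc K0 cont]
  \<comment> \<open>By \<open>no\<close> for constant sequences each \<open>G n\<close> is nonzero
    somewhere; testing at such points excludes finitely many indices.\<close>
  have inf: "infinite M" if E: "?E M" for M
  proof
    assume M: "finite M"
    have "\<exists>t\<in>\<Union>k. K k. G n t \<noteq> 0" for n using no[of "\<lambda>_. n"] by (metis tendsto_const)
    then obtain f where f: "\<And>n. f n \<in> (\<Union>k. K k)" "\<And>n. G n (f n) \<noteq> 0" by metis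
    define e where "e = Min (insert 1 ((\<lambda>n. \<bar>G n (f n)\<bar>) ` M))"
    have "e > 0" using M f by (auto simp: e_def)
    moreover have "f ` M \<subseteq> (\<Union>k. K k)" using f by auto
    ultimately obtain n where "n \<in> M" "\<bar>G n (f n)\<bar> < e"
      using pointwise_clusters_0D[OF E, of "f ` M" e] M by blast
    then show False using M by (simp add: e_def) (metis less_irrefl)
  qed
  define osc where "osc N m \<longleftrightarrow> (\<forall>M\<subseteq>N. ?E M \<longrightarrow> (\<exists>t\<in>K m. infinite {n\<in>M. \<bar>G n t\<bar> \<ge> 1 / Suc m}))" for N m
  \<comment> \<open>Otherwise clustering sets shrink so that at stage \<open>m\<close> each point of
    \<open>K m\<close> sees only finitely many values of size at least \<open>1 / Suc m\<close>;
    enumerating a pseudo-intersection then gives a sequence converging to 0.\<close>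
  have "\<exists>N m. ?E N \<and> osc N m"
  proof (rule ccontr)
    assume "\<not> ?thesis"
    then have "\<not> osc N m" if "?E N" for N m
      using that by auto
    then have *: "\<exists>M. M \<subseteq> N \<and> ?E M \<and> (\<forall>t\<in>K m. finite {n\<in>M. \<bar>G n t\<bar> \<ge> 1 / Suc m})" if "?E N" for N m
      using that by (auto simp: osc_def)
    define c where "c N m = (SOME M. M \<subseteq> N \<and> ?E M \<and> (\<forall>t\<in>K m. finite {n\<in>M. \<bar>G n t\<bar> \<ge> 1 / Suc m}))" for N m
    have c: "c N m \<subseteq> N" "?E (c N m)" "\<And>t. t \<in> K m \<Longrightarrow> finite {n\<in>c N m. \<bar>G n t\<bar> \<ge> 1 / Suc m}"
      if "?E N" for N m
      using someI_ex[OF *[OF that, of m]] unfolding c_def[symmetric] by blast+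
    define M where "M = rec_nat UNIV (\<lambda>m N. c N m)"
    have M: "?E (M m)" for m by (induction m) (auto simp: M_def clus c)
    have dec: "M (Suc m) \<subseteq> M m" and small: "\<And>t. t \<in> K m \<Longrightarrow> finite {n\<in>M (Suc m). \<bar>G n t\<bar> \<ge> 1 / Suc m}" for m
      using c(1,3)[OF M[of m]] by (auto simp: M_def)
    have "decseq M" using dec by (simp add: decseq_Suc_iff)
    from pseudo[OF M this] obtain N where N: "?E N" "\<And>k. finite (N - M k)" by blast
    have "(\<lambda>k. G (enumerate N k) t) \<longlonglongrightarrow> 0" if "t \<in> (\<Union>k. K k)" for t
    proof (rule LIMSEQ_I)
      fix e :: real assume "e > 0"
      obtain m0 where "t \<in> K m0" using \<open>t \<in> _\<close> by auto
      obtain n' :: nat where n': "1 / Suc n' < e" using \<open>e > 0\<close> nat_approx_posE by blast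
      define m where "m = max m0 n'"
      have t: "t \<in> K m" using \<open>t \<in> K m0\<close> inc unfolding m_def incseq_def by (meson max.cobounded1 subsetD)
      have "1 / Suc m \<le> 1 / Suc n'" by (intro divide_left_mono) (auto simp: m_def)
      then have m: "1 / Suc m < e" using n' by simp
      have "finite {n\<in>N. \<bar>G n t\<bar> \<ge> e}"
        by (rule finite_subset[of _ "(N - M (Suc m)) \<union> {n\<in>M (Suc m). \<bar>G n t\<bar> \<ge> 1 / Suc m}"])
          (use m N small[OF t] in auto)
      then obtain b where b: "{n\<in>N. \<bar>G n t\<bar> \<ge> e} \<subseteq> {..<b}" by (metis finite_nat_bounded)
      have "norm (G (enumerate N k) t - 0) < e" if "k \<ge> b" for k
      proof -
        have "enumerate N k \<in> N" "enumerate N k \<ge> b"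
          using enumerate_in_set[OF inf[OF N(1)]] le_enumerate[OF inf[OF N(1)], of k] that by auto
        then have "enumerate N k \<notin> {n\<in>N. \<bar>G n t\<bar> \<ge> e}" using b by auto
        with \<open>enumerate N k \<in> N\<close> show ?thesis by simp
      qed
      then show "\<exists>no. \<forall>k\<ge>no. norm (G (enumerate N k) t - 0) < e" by blast
    qed
    then show False using no by blast
  qed
  then obtain N0 m where N0: "?E N0"
    and osc: "\<And>M. M \<subseteq> N0 \<Longrightarrow> ?E M \<Longrightarrow> \<exists>t\<in>K m. infinite {n\<in>M. \<bar>G n t\<bar> \<ge> 1 / Suc m}"
    unfolding osc_def by auto
  define \<epsilon> where "\<epsilon> = 1 / Suc m"
  have "\<epsilon> > 0" by (simp add: \<epsilon>_def)
  \<comment> \<open>Intersecting with \<open>N0\<close> keeps the oscillation available inside every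
    set of \<open>U\<close>.\<close>
  obtain U where UE: "\<And>M. M \<in> U \<Longrightarrow> ?E (M \<inter> N0)"
    and U: "\<And>M N. M \<in> U \<Longrightarrow> M \<subseteq> N \<Longrightarrow> N \<in> U" "\<And>M N. M \<in> U \<Longrightarrow> N \<in> U \<Longrightarrow> M \<inter> N \<in> U"
      "\<And>M. M \<in> U \<or> - M \<in> U"
  proof (rule ultrafilter_of_partition_regular[of "\<lambda>M. ?E (M \<inter> N0)"])
    show "?E (M \<inter> N0) \<or> ?E (N \<inter> N0)" if "?E ((M \<union> N) \<inter> N0)" for M N
      using that pointwise_clusters_0_Un by (metis Int_Un_distrib2)
    show "?E (N \<inter> N0)" if "?E (M \<inter> N0)" "M \<subseteq> N" for M N
      using that by (meson Int_mono order_refl pointwise_clusters_0_mono)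
  qed (use N0 in auto)
  interpret free_ultrafilter U
    by unfold_locales (use U UE inf in \<open>blast+\<close>)
  have near: "{n. \<bar>G n t\<bar> < e} \<in> U" if "t \<in> (\<Union>k. K k)" "e > 0" for t e
  proof (rule ccontr)
    assume "{n. \<bar>G n t\<bar> < e} \<notin> U"
    then have "?E (- {n. \<bar>G n t\<bar> < e} \<inter> N0)" using UE either by blast
    from pointwise_clusters_0D[OF this, of "{t}" e] that show False by auto
  qed
  \<comment> \<open>Small at even and large at odd positions, with a gap of
    \<open>\<epsilon> / 2\<close>; the weak inequalities keep these sets closed.\<close>
  define Z where "Z n i = {t. if odd i then \<bar>G n t\<bar> \<ge> \<epsilon> else \<bar>G n t\<bar> \<le> \<epsilon> / 2}" for n and i :: nat
  have clZ: "closed (Z n i)" for n i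
    unfolding Z_def using cont by (cases "odd i") (auto intro!: closed_Collect_le continuous_intros)
  define Q where "Q s \<longleftrightarrow> (\<exists>t\<in>K m. \<forall>i<length s. t \<in> Z (s ! i) i)" for s
  show False
  proof (cases "barred Q U []")
    case True
    then obtain S where S: "\<And>t. S t \<in> U"
      and leave: "\<And>\<mu>. (\<And>j. \<mu> j \<in> S (map \<mu> [0..<j])) \<Longrightarrow> \<exists>j. \<not> Q (map \<mu> [0..<j])"
      using barred_strategy[OF True] by fastforce
    \<comment> \<open>There are countably many lists, so a pseudo-intersection of the
      \<open>M k\<close> is almost contained in every set \<open>S s\<close> of the
      strategy.\<close>
    define M where "M k = (\<Inter>j\<in>{..k}. S (from_nat j)) \<inter> N0" for k
    have EM: "?E (M k)" for k unfolding M_def by (intro UE INT_mem) (auto intro: S)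
    have "decseq M" by (auto simp: decseq_def M_def)
    from pseudo[OF EM this] obtain N where N: "?E N" "\<And>k. finite (N - M k)" by blast
    have NS: "finite (N - S s)" for s
      by (rule finite_subset[OF _ N(2)[of "to_nat s"]]) (auto simp: M_def)
    have "?E (N \<inter> N0)"
    proof -
      have "finite (N - N0)" by (rule finite_subset[OF _ N(2)[of 0]]) (auto simp: M_def)
      moreover have "?E ((N \<inter> N0) \<union> (N - N0))" using N(1) by (simp add: Int_Diff_Un)
      ultimately show ?thesis using pointwise_clusters_0_Un inf by blast
    qed
    from osc[OF _ this] obtain t where t: "t \<in> K m" "infinite {n\<in>N \<inter> N0. \<bar>G n t\<bar> \<ge> \<epsilon>}"
      unfolding \<epsilon>_def by auto
    \<comment> \<open>The same \<open>t\<close> answers at every list: large values recur along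
      \<open>N\<close>, which is almost inside \<open>S s\<close>, and small values are
      \<open>U\<close>-large.\<close>
    have "\<exists>n\<in>S s. t \<in> Z n (length s)" for s
    proof (cases "odd (length s)")
      case True
      have "infinite ({n\<in>N \<inter> N0. \<bar>G n t\<bar> \<ge> \<epsilon>} - (N - S s))" using t(2) NS by (simp add: Diff_infinite_finite)
      then obtain n where "n \<in> {n\<in>N \<inter> N0. \<bar>G n t\<bar> \<ge> \<epsilon>} - (N - S s)" using infinite_imp_nonempty by blast
      then show ?thesis using True by (auto simp: Z_def)
    next
      case False
      have "S s \<inter> {n. \<bar>G n t\<bar> < \<epsilon> / 2} \<in> U" using t(1) \<open>\<epsilon> > 0\<close> by (intro inter S near) auto
      then obtain n where "n \<in> S s \<inter> {n. \<bar>G n t\<bar> < \<epsilon> / 2}" using infinite infinite_imp_nonempty by blast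
      then show ?thesis using False by (auto simp: Z_def intro!: bexI[of _ n])
    qed
    then have "\<forall>s. \<exists>n. n \<in> S s \<and> t \<in> Z n (length s)" by blast
    from choice[OF this] obtain c where c: "\<And>s. c s \<in> S s" "\<And>s. t \<in> Z (c s) (length s)" by auto
    obtain \<mu> where \<mu>: "\<And>k. \<mu> k = c (map \<mu> [0..<k])" using recursive_sequence[of c] by blast
    have "\<mu> j \<in> S (map \<mu> [0..<j])" for j using c(1)[of "map \<mu> [0..<j]"] \<mu>[of j] by simp
    then obtain j where "\<not> Q (map \<mu> [0..<j])" using leave by blast
    moreover have "t \<in> Z (\<mu> i) i" for i using c(2)[of "map \<mu> [0..<i]"] \<mu>[of i] by simp
    ultimately show False using t(1) by (auto simp: Q_def)
  next
    case False
    then obtain \<nu> :: "nat \<Rightarrow> nat" where \<nu>: "strict_mono \<nu>"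
      "\<And>r k. strict_mono r \<Longrightarrow> Q (map (\<nu> \<circ> r) [0..<k])"
      by (rule unbarred_sequence) blast
    obtain r where r: "strict_mono r" "\<And>t. t \<in> (\<Union>k. K k) \<Longrightarrow> Cauchy (\<lambda>k. G (\<nu> (r k)) t)"
      using cauchy[OF \<nu>(1)] by blast
    have "\<exists>t\<in>K m. \<forall>i. t \<in> Z (\<nu> (r i)) i"
    proof (rule compact_closed_sequence[OF comp[of m]])
      show "closed (Z (\<nu> (r i)) i)" for i by (rule clZ)
      show "\<exists>t\<in>K m. \<forall>i<k. t \<in> Z (\<nu> (r i)) i" for k using \<nu>(2)[OF r(1), of k] by (simp add: Q_def)
    qed
    then obtain t where t: "t \<in> K m" "\<And>i. t \<in> Z (\<nu> (r i)) i" by blast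
    have "Cauchy (\<lambda>k. G (\<nu> (r k)) t)" using t(1) r(2) by blast
    then obtain M where M: "\<And>i j. i \<ge> M \<Longrightarrow> j \<ge> M \<Longrightarrow> norm (G (\<nu> (r i)) t - G (\<nu> (r j)) t) < \<epsilon> / 2"
      using \<open>\<epsilon> > 0\<close> by (meson CauchyD half_gt_zero)
    have "\<bar>G (\<nu> (r (Suc (2 * M)))) t\<bar> \<ge> \<epsilon>" "\<bar>G (\<nu> (r (2 * M))) t\<bar> \<le> \<epsilon> / 2"
      using t(2)[of "Suc (2 * M)"] t(2)[of "2 * M"] by (auto simp: Z_def)
    moreover have "\<bar>G (\<nu> (r (Suc (2 * M)))) t - G (\<nu> (r (2 * M))) t\<bar> < \<epsilon> / 2"
      using M[of "Suc (2 * M)" "2 * M"] by simp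
    ultimately show False by linarith
  qed
qed

section \<open>Rosenthal's theorem\<close>

lemma alternating_sequence:
  assumes A: "infinite A" and B: "infinite (B :: nat set)"
  shows "\<exists>r :: nat \<Rightarrow> nat. strict_mono r \<and> (\<forall>k. if even k then r k \<in> A else r k \<in> B)"
proof -
  define V where "V k = (if even k then A else B)" for k :: nat
  have "infinite (V k)" for k using A B by (simp add: V_def)
  then have ex: "\<exists>n. m < n \<and> n \<in> V k" for k m by (auto simp: infinite_nat_iff_unbounded)
  define c where "c k m = (SOME n. m < n \<and> n \<in> V k)" for k m
  have c: "m < c k m" "c k m \<in> V k" for k m using someI_ex[OF ex[of m k]] by (simp_all add: c_def)
  define r where "r = rec_nat (c 0 0) (\<lambda>k m. c (Suc k) m)"
  have "strict_mono r" by (auto simp: strict_mono_Suc_iff r_def c)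
  moreover have "r k \<in> V k" for k
    using c(2) by (cases k) (simp_all add: r_def)
  ultimately show ?thesis unfolding V_def by (metis (full_types))
qed

text \<open>A subsequential limit is approached infinitely often, while infinitely many terms stay
  away from it on one side. Rational bounds leave only countably many pairs to be treated.\<close>

lemma bounded_not_Cauchy_oscillates:
  fixes u :: "nat \<Rightarrow> real"
  assumes bdd: "bounded (range u)" and "\<not> Cauchy u"
  obtains a b :: rat where "a < b" "infinite {k. u k \<le> of_rat a}" "infinite {k. u k \<ge> of_rat b}"
proof -
  obtain l r where r: "strict_mono r" "(u \<circ> r) \<longlonglongrightarrow> l"
    using bounded_imp_convergent_subsequence[OF bdd] by metis
  have "\<not> u \<longlonglongrightarrow> l" using assms(2) LIMSEQ_imp_Cauchy by blast
  then obtain e where "e > 0" and e: "\<And>N. \<exists>k\<ge>N. \<bar>u k - l\<bar> \<ge> e"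
    unfolding LIMSEQ_iff by (auto simp: not_less)
  have near: "infinite {k. \<bar>u k - l\<bar> < e / 2}"
    unfolding infinite_nat_iff_unbounded_le
  proof
    fix N
    obtain M where M: "\<And>k. k \<ge> M \<Longrightarrow> \<bar>u (r k) - l\<bar> < e / 2"
      using LIMSEQ_D[OF r(2), of "e / 2"] \<open>e > 0\<close> by (auto simp: comp_def)
    have "r (max N M) \<ge> N" using seq_suble[OF r(1), of "max N M"] by simp
    then show "\<exists>n\<ge>N. n \<in> {k. \<bar>u k - l\<bar> < e / 2}" using M[of "max N M"] by auto
  qed
  have "infinite {k. \<bar>u k - l\<bar> \<ge> e}"
    unfolding infinite_nat_iff_unbounded_le using e by auto
  moreover have "{k. \<bar>u k - l\<bar> \<ge> e} \<subseteq> {k. u k \<ge> l + e} \<union> {k. u k \<le> l - e}" by auto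
  ultimately have "infinite {k. u k \<ge> l + e} \<or> infinite {k. u k \<le> l - e}"
    by (meson finite_Un finite_subset)
  then show thesis
  proof
    assume inf: "infinite {k. u k \<ge> l + e}"
    obtain a where a: "l + e / 2 < of_rat a" "of_rat a < l + e"
      using of_rat_dense[of "l + e / 2" "l + e"] \<open>e > 0\<close> by auto
    obtain b where b: "of_rat a < (of_rat b :: real)" "of_rat b < l + e"
      using of_rat_dense[of "of_rat a" "l + e"] a by auto
    have "u k \<le> of_rat a" if "\<bar>u k - l\<bar> < e / 2" for k using abs_le_D1[OF less_imp_le[OF that]] a(1) by linarith
    then have "{k. \<bar>u k - l\<bar> < e / 2} \<subseteq> {k. u k \<le> of_rat a}" by blast
    moreover have "{k. u k \<ge> l + e} \<subseteq> {k. u k \<ge> of_rat b}" using b(2) by auto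
    ultimately show thesis using near inf b(1) by (intro that[of a b]) (auto simp: of_rat_less dest: finite_subset)
  next
    assume inf: "infinite {k. u k \<le> l - e}"
    obtain a where a: "l - e < of_rat a" "of_rat a < l - e / 2"
      using of_rat_dense[of "l - e" "l - e / 2"] \<open>e > 0\<close> by auto
    obtain b where b: "of_rat a < (of_rat b :: real)" "of_rat b < l - e / 2"
      using of_rat_dense[of "of_rat a" "l - e / 2"] a by auto
    have "u k \<ge> of_rat b" if "\<bar>u k - l\<bar> < e / 2" for k using abs_le_D2[OF less_imp_le[OF that]] b(2) by linarith
    then have "{k. \<bar>u k - l\<bar> < e / 2} \<subseteq> {k. u k \<ge> of_rat b}" by blast
    moreover have "{k. u k \<le> l - e} \<subseteq> {k. u k \<le> of_rat a}" using a(1) by auto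
    ultimately show thesis using near inf b(1) by (intro that[of a b]) (auto simp: of_rat_less dest: finite_subset)
  qed
qed

lemma free_ultrafilter_exists: "\<exists>U. free_ultrafilter U"
proof -
  obtain U :: "nat set set" where "\<And>M. M \<in> U \<Longrightarrow> infinite M"
    "\<And>M N. M \<in> U \<Longrightarrow> M \<subseteq> N \<Longrightarrow> N \<in> U" "\<And>M N. M \<in> U \<Longrightarrow> N \<in> U \<Longrightarrow> M \<inter> N \<in> U"
    "\<And>M. M \<in> U \<or> - M \<in> U"
    by (rule ultrafilter_of_partition_regular[of "infinite :: nat set \<Rightarrow> bool"])
      (auto dest: finite_subset)
  then show ?thesis by (intro exI[of _ U] free_ultrafilter.intro)
qed

text \<open>If all triples of a compact set and rational bounds \<open>a j < b j\<close> were
  barred, one diagonal sequence would serve all strategies; at a point where it is not Cauchy, an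
  alternating subsequence obeys a strategy without ever leaving \<open>Q j\<close>. So some triple
  is unbarred, and alternation along all subsequences becomes Boolean independence on every third
  index.\<close>

theorem Rosenthal_dichotomy:
  fixes G :: "nat \<Rightarrow> 'k::topological_space \<Rightarrow> real" and K :: "nat \<Rightarrow> 'k set"
  assumes comp: "\<And>k. compact (K k)" and cont: "\<And>n. continuous_on UNIV (G n)"
    and bdd: "\<And>t. t \<in> (\<Union>k. K k) \<Longrightarrow> bounded (range (\<lambda>n. G n t))"
    and no: "\<And>r :: nat \<Rightarrow> nat. strict_mono r \<Longrightarrow> \<exists>t\<in>\<Union>k. K k. \<not> Cauchy (\<lambda>k. G (r k) t)"
  obtains m a b and \<nu> :: "nat \<Rightarrow> nat" where "a < b"
    "\<And>B. \<exists>t\<in>K m. \<forall>i. if i \<in> B then G (\<nu> i) t \<le> a else b \<le> G (\<nu> i) t"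
proof -
  obtain U where "free_ultrafilter U" using free_ultrafilter_exists by blast
  then interpret free_ultrafilter U .
  define m where "m j = fst (from_nat j :: nat \<times> rat \<times> rat)" for j
  define a where "a j = (of_rat (fst (snd (from_nat j :: nat \<times> rat \<times> rat))) :: real)" for j
  define b where "b j = (of_rat (snd (snd (from_nat j :: nat \<times> rat \<times> rat))) :: real)" for j
  define Z where "Z j n i = {t. if even i then G n t \<le> a j else b j \<le> G n t}" for j n and i :: nat
  define Q where "Q j s \<longleftrightarrow> (\<exists>t\<in>K (m j). \<forall>i<length s. t \<in> Z j (s ! i) i)" for j s
  have clZ: "closed (Z j n i)" for j n i
    unfolding Z_def using cont by (cases "even i") (auto intro!: closed_Collect_le continuous_intros)
  have "\<exists>j. a j < b j \<and> \<not> barred (Q j) U []"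
  proof (rule ccontr)
    assume "\<not> ?thesis"
    then have bar: "barred (Q j) U []" if "a j < b j" for j using that by blast
    have "\<exists>S. (\<forall>s. S s \<in> U) \<and> (a j < b j \<longrightarrow>
      (\<forall>\<mu>. (\<forall>i. \<mu> i \<in> S (map \<mu> [0..<i])) \<longrightarrow> (\<exists>i. \<not> Q j (map \<mu> [0..<i]))))" for j
    proof (cases "a j < b j")
      case True
      from barred_strategy[OF bar[OF this]] show ?thesis by fastforce
    qed (use UNIV_mem in auto)
    then have "\<forall>j. \<exists>S. (\<forall>s. S s \<in> U) \<and> (a j < b j \<longrightarrow>
      (\<forall>\<mu>. (\<forall>i. \<mu> i \<in> S (map \<mu> [0..<i])) \<longrightarrow> (\<exists>i. \<not> Q j (map \<mu> [0..<i]))))" by blast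
    from choice[OF this] obtain S where S0: "\<forall>j. (\<forall>s. S j s \<in> U) \<and> (a j < b j \<longrightarrow>
      (\<forall>\<mu>. (\<forall>i. \<mu> i \<in> S j (map \<mu> [0..<i])) \<longrightarrow> (\<exists>i. \<not> Q j (map \<mu> [0..<i]))))" ..
    have S: "S j s \<in> U" for j s using S0 by blast
    have leave: "\<exists>i. \<not> Q j (map \<mu> [0..<i])" if "a j < b j" "\<forall>i. \<mu> i \<in> S j (map \<mu> [0..<i])" for j \<mu>
      using S0 that by blast
    \<comment> \<open>The strategy for the \<open>j\<close>-th triple is only followed from position \<open>2 * j\<close> on; the offset is
      even so that it preserves the alternation pattern.\<close>
    define S' where "S' s = (\<Inter>j\<in>{j. 2 * j \<le> length s}. S j (drop (2 * j) s))" for s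
    have "S' s \<in> U" for s
      unfolding S'_def by (rule INT_mem) (auto intro: S finite_subset[of _ "{..length s}"])
    then obtain \<nu> :: "nat \<Rightarrow> nat" where \<nu>: "strict_mono \<nu>"
      "\<And>r k. strict_mono r \<Longrightarrow> \<nu> (r k) \<in> S' (map (\<nu> \<circ> r) [0..<k])"
      by (rule diagonal_sequence[of S']) blast
    obtain t where t: "t \<in> (\<Union>k. K k)" "\<not> Cauchy (\<lambda>k. G (\<nu> k) t)" using no[OF \<nu>(1)] by blast
    have "bounded (range (\<lambda>k. G (\<nu> k) t))"
      by (rule bounded_subset[OF bdd[OF t(1)]]) auto
    then obtain a' b' where ab: "a' < b'" "infinite {k. G (\<nu> k) t \<le> of_rat a'}" "infinite {k. G (\<nu> k) t \<ge> of_rat b'}"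
      using bounded_not_Cauchy_oscillates t(2) by blast
    obtain m' where m': "t \<in> K m'" using t(1) by blast
    define j where "j = to_nat (m', a', b')"
    have j: "m j = m'" "a j = of_rat a'" "b j = of_rat b'" by (auto simp: j_def m_def a_def b_def)
    obtain r :: "nat \<Rightarrow> nat" where r: "strict_mono r"
      "\<forall>k. if even k then r k \<in> {k. G (\<nu> k) t \<le> of_rat a'} else r k \<in> {k. G (\<nu> k) t \<ge> of_rat b'}"
      using alternating_sequence[OF ab(2,3)] by blast
    define \<mu> where "\<mu> i = \<nu> (r (2 * j + i))" for i
    have "\<mu> i \<in> S j (map \<mu> [0..<i])" for i
    proof -
      have "drop (2 * j) (map (\<nu> \<circ> r) [0..<2 * j + i]) = map \<mu> [0..<i]"
        by (rule nth_equalityI) (auto simp: \<mu>_def)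
      moreover have "\<nu> (r (2 * j + i)) \<in> S j (drop (2 * j) (map (\<nu> \<circ> r) [0..<2 * j + i]))"
        by (rule INT_D[OF \<nu>(2)[OF r(1), of "2 * j + i", unfolded S'_def]]) simp
      ultimately show ?thesis by (simp only: \<mu>_def[of i])
    qed
    then obtain i where "\<not> Q j (map \<mu> [0..<i])" using leave[of j \<mu>] ab(1) j by (auto simp: of_rat_less)
    moreover have "t \<in> Z j (\<mu> i) i" for i
      using r(2)[rule_format, of "2 * j + i"] by (auto simp: Z_def \<mu>_def j split: if_splits)
    ultimately show False using m' by (auto simp: Q_def j)
  qed
  then obtain j where j: "a j < b j" "\<not> barred (Q j) U []" by blast
  obtain \<nu> :: "nat \<Rightarrow> nat" where \<nu>: "\<And>r k. strict_mono r \<Longrightarrow> Q j (map (\<nu> \<circ> r) [0..<k])"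
    by (rule unbarred_sequence[OF j(2)]) blast
  show thesis
  proof (rule that[OF j(1)])
    fix B :: "nat set"
    \<comment> \<open>Each index \<open>3 * i + 1\<close> is put at an even or an odd position by adding
      its right or its left neighbour.\<close>
    define r where "r k = 3 * (k div 2) + of_bool (k div 2 \<in> B) + k mod 2" for k
    have r: "strict_mono r"
      unfolding strict_mono_Suc_iff
    proof
      show "r k < r (Suc k)" for k
        by (cases "even k") (auto simp: r_def elim!: evenE oddE)
    qed
    have "\<exists>t\<in>K (m j). \<forall>i. t \<in> Z j (\<nu> (r i)) i"
    proof (rule compact_closed_sequence[OF comp clZ])
      show "\<exists>t\<in>K (m j). \<forall>i<k. t \<in> Z j (\<nu> (r i)) i" for k using \<nu>[OF r, of k] by (simp add: Q_def)
    qed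
    then obtain t where t: "t \<in> K (m j)" "\<And>i. t \<in> Z j (\<nu> (r i)) i" by blast
    have "if i \<in> B then G (\<nu> (3 * i + 1)) t \<le> a j else b j \<le> G (\<nu> (3 * i + 1)) t" for i
      using t(2)[of "2 * i"] t(2)[of "2 * i + 1"] by (auto simp: Z_def r_def)
    then show "\<exists>t\<in>K (m j). \<forall>i. if i \<in> B then G (\<nu> (3 * i + 1)) t \<le> a j else b j \<le> G (\<nu> (3 * i + 1)) t"
      using t(1) by blast
  qed
qed

section \<open>Brouwer's theorem and weak approximate fixed points\<close>

lemma tendsto_funI:
  fixes f :: "'c \<Rightarrow> 'i \<Rightarrow> 'b::topological_space"
  assumes "\<And>i. ((\<lambda>c. f c i) \<longlongrightarrow> l i) F"
  shows "(f \<longlongrightarrow> l) F"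
  using assms limitin_componentwise[of "\<lambda>_. euclidean" UNIV f l F]
  by (simp add: euclidean_product_topology)

lemma tendsto_fun_component:
  fixes f :: "'c \<Rightarrow> 'i \<Rightarrow> 'b::topological_space"
  assumes "(f \<longlongrightarrow> l) F"
  shows "((\<lambda>c. f c i) \<longlongrightarrow> l i) F"
  using assms limitin_componentwise[of "\<lambda>_. euclidean" UNIV f l F]
  by (simp add: euclidean_product_topology)

text \<open>Kuhn's combinatorial lemma on ever finer grids. The dimension \<open>n\<close> is a
  variable, so the cube occupies the first \<open>n\<close> coordinates of a sequence space and grid
  points are 0 elsewhere.\<close>

theorem brouwer_function_cube:
  fixes h :: "(nat \<Rightarrow> real) \<Rightarrow> nat \<Rightarrow> real"
  assumes cont: "\<And>i. i < n \<Longrightarrow> continuous_on UNIV (\<lambda>y. h y i)"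
    and range: "\<And>y i. i < n \<Longrightarrow> h y i \<in> {0..1}"
  obtains y where "\<And>i. i < n \<Longrightarrow> h y i = y i"
proof -
  define pt :: "nat \<Rightarrow> (nat \<Rightarrow> nat) \<Rightarrow> nat \<Rightarrow> real" where
    "pt p x j = (if j < n then x j / p else 0)" for p x j
  define near :: "(nat \<Rightarrow> nat) \<Rightarrow> (nat \<Rightarrow> nat) \<Rightarrow> bool" where
    "near q r \<longleftrightarrow> (\<forall>j<n. q j \<le> r j \<and> r j \<le> q j + 1)" for q r
  have "\<exists>q. (\<forall>i<n. q i < p) \<and> (\<forall>i<n. \<exists>r s. near q r \<and> near q s \<and>
    pt p r i \<le> h (pt p r) i \<and> h (pt p s) i \<le> pt p s i)" if "p > 0" for p
  proof -
    \<comment> \<open>The label records the direction in which \<open>h\<close> moves a coordinate.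
      The boundary values that Kuhn's lemma demands agree with this because \<open>h\<close> maps
      into the unit interval.\<close>
    define label where "label x i = (if x i = 0 then 0 else if x i = p then 1
      else if pt p x i \<le> h (pt p x) i then 0 else (1::nat))" for x i
    obtain q where q: "\<forall>i<n. q i < p" and lab: "\<forall>i<n. \<exists>r s. (\<forall>j<n. q j \<le> r j \<and> r j \<le> q j + 1) \<and>
      (\<forall>j<n. q j \<le> s j \<and> s j \<le> q j + 1) \<and> label r i \<noteq> label s i"
      by (rule kuhn_lemma[OF \<open>p > 0\<close>, of n label]) (use \<open>p > 0\<close> in \<open>auto simp: label_def\<close>)
    have le1: "label x i \<le> 1" for x i by (simp add: label_def)
    have 0: "pt p x i \<le> h (pt p x) i" if "label x i = 0" "i < n" for x i
      using that range[of i "pt p x"] by (auto simp: label_def pt_def split: if_splits)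
    have 1: "h (pt p x) i \<le> pt p x i" if "label x i \<noteq> 0" "i < n" for x i
      using that range[of i "pt p x"] \<open>p > 0\<close> by (auto simp: label_def pt_def split: if_splits)
    have "\<exists>r s. near q r \<and> near q s \<and> pt p r i \<le> h (pt p r) i \<and> h (pt p s) i \<le> pt p s i"
      if i: "i < n" for i
    proof -
      obtain r s where rs: "near q r" "near q s" "label r i \<noteq> label s i"
        using lab[rule_format, OF i] unfolding near_def by blast
      then have "label r i = 0 \<and> label s i \<noteq> 0 \<or> label s i = 0 \<and> label r i \<noteq> 0"
        using le1[of r i] le1[of s i] by arith
      then show ?thesis using rs 0[OF _ i] 1[OF _ i] by blast
    qed
    then show ?thesis using q by blast
  qed
  then have "\<forall>k. \<exists>q. (\<forall>i<n. q i < Suc k) \<and> (\<forall>i<n. \<exists>r s. near q r \<and> near q s \<and>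
    pt (Suc k) r i \<le> h (pt (Suc k) r) i \<and> h (pt (Suc k) s) i \<le> pt (Suc k) s i)" by blast
  from choice[OF this] obtain q where q: "\<And>k i. i < n \<Longrightarrow> q k i < Suc k"
    and rs: "\<And>k i. i < n \<Longrightarrow> \<exists>r s. near (q k) r \<and> near (q k) s \<and>
      pt (Suc k) r i \<le> h (pt (Suc k) r) i \<and> h (pt (Suc k) s) i \<le> pt (Suc k) s i" by blast
  define a where "a k = pt (Suc k) (q k)" for k
  have "compact {t :: nat \<Rightarrow> real. \<forall>j. t j \<in> {0..1}}" by (rule compact_functions) simp
  moreover have "a k \<in> {t. \<forall>j. t j \<in> {0..1}}" for k
  proof -
    have "real (q k j) \<le> real (Suc k)" if "j < n" for j using q[OF that, of k] by linarith
    then show ?thesis by (auto simp: a_def pt_def)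
  qed
  ultimately obtain y s where s: "strict_mono s" and y: "(a \<circ> s) \<longlonglongrightarrow> y"
    by (metis (lifting) compact_eq_seq_compact_metric seq_compactE)
  \<comment> \<open>All vertices of the shrinking cells tend to the same \<open>y\<close>, so
    vertices with opposite inequalities force \<open>h y i = y i\<close>.\<close>
  have lim: "(\<lambda>k. h (pt (Suc (s k)) (r k)) i - pt (Suc (s k)) (r k) i) \<longlonglongrightarrow> h y i - y i"
    if r: "\<And>k. near (q (s k)) (r k)" and i: "i < n" for r i
  proof -
    have c: "(\<lambda>k. pt (Suc (s k)) (r k) j) \<longlonglongrightarrow> y j" for j
    proof -
      have "norm (pt (Suc (s k)) (r k) j - a (s k) j) \<le> 1 / real (Suc k)" for k
      proof (cases "j < n")
        case True
        then have "real (r k j) \<le> real (q (s k) j) + 1" "real (q (s k) j) \<le> real (r k j)"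
          using r[of k] by (auto simp: near_def)
        then have "\<bar>real (r k j) - real (q (s k) j)\<bar> / Suc (s k) \<le> 1 / Suc (s k)"
          by (intro divide_right_mono) auto
        moreover have "pt (Suc (s k)) (r k) j - a (s k) j = (real (r k j) - real (q (s k) j)) / Suc (s k)"
          using True by (simp add: a_def pt_def diff_divide_distrib)
        moreover have "1 / real (Suc (s k)) \<le> 1 / Suc k"
          using seq_suble[OF s, of k] by (intro divide_left_mono) auto
        ultimately show ?thesis by (simp add: abs_divide)
      qed (simp add: a_def pt_def)
      from Lim_null_comparison[OF always_eventually[OF allI[OF this]] LIMSEQ_Suc[OF lim_1_over_n]]
      have "(\<lambda>k. pt (Suc (s k)) (r k) j - a (s k) j) \<longlonglongrightarrow> 0" .
      moreover have "(\<lambda>k. a (s k) j) \<longlonglongrightarrow> y j" using tendsto_fun_component[OF y, of j] by simp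
      ultimately have "(\<lambda>k. (pt (Suc (s k)) (r k) j - a (s k) j) + a (s k) j) \<longlonglongrightarrow> 0 + y j"
        by (rule tendsto_add)
      then show ?thesis by simp
    qed
    have "(\<lambda>k. pt (Suc (s k)) (r k)) \<longlonglongrightarrow> y" using c by (rule tendsto_funI)
    then have "(\<lambda>k. h (pt (Suc (s k)) (r k)) i) \<longlonglongrightarrow> h y i"
      using continuous_on_tendsto_compose[OF cont[OF i]] by simp
    then show ?thesis using c by (intro tendsto_diff)
  qed
  have "h y i = y i" if i: "i < n" for i
  proof -
    from rs[OF i] have "\<forall>k. \<exists>r. near (q (s k)) r \<and> pt (Suc (s k)) r i \<le> h (pt (Suc (s k)) r) i" by blast
    from choice[OF this] obtain r where r: "\<And>k. near (q (s k)) (r k)"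
      "\<And>k. 0 \<le> h (pt (Suc (s k)) (r k)) i - pt (Suc (s k)) (r k) i" by auto
    from rs[OF i] have "\<forall>k. \<exists>r. near (q (s k)) r \<and> h (pt (Suc (s k)) r) i \<le> pt (Suc (s k)) r i" by blast
    from choice[OF this] obtain r' where r': "\<And>k. near (q (s k)) (r' k)"
      "\<And>k. h (pt (Suc (s k)) (r' k)) i - pt (Suc (s k)) (r' k) i \<le> 0" by auto
    have "0 \<le> h y i - y i" using LIMSEQ_le_const[OF lim[OF r(1) i]] r(2) by blast
    moreover have "h y i - y i \<le> 0" using LIMSEQ_le_const2[OF lim[OF r'(1) i]] r'(2) by blast
    ultimately show ?thesis by simp
  qed
  then show thesis by (rule that)
qed

lemma locally_convex_topologyD:
  assumes "locally_convex_topology T"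
  shows "topspace T = UNIV" "continuous_map (prod_topology T T) T (\<lambda>(x, y). x + y)"
    "continuous_map (prod_topology euclideanreal T) T (\<lambda>(r, x). r *\<^sub>R x)"
  using assms by (auto simp: locally_convex_topology_def)

lemma continuous_map_vector_add:
  assumes "locally_convex_topology T" "continuous_map X T u" "continuous_map X T v"
  shows "continuous_map X T (\<lambda>z. u z + v z)"
proof -
  have "continuous_map X (prod_topology T T) (\<lambda>z. (u z, v z))"
    using assms by (simp add: continuous_map_pairedI)
  from continuous_map_compose[OF this locally_convex_topologyD(2)[OF assms(1)]]
  show ?thesis by (simp add: comp_def)
qed

lemma continuous_map_vector_scaleR:
  assumes "locally_convex_topology T" "continuous_map X euclideanreal c" "continuous_map X T u"
  shows "continuous_map X T (\<lambda>z. c z *\<^sub>R u z)"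
proof -
  have "continuous_map X (prod_topology euclideanreal T) (\<lambda>z. (c z, u z))"
    using assms by (simp add: continuous_map_pairedI)
  from continuous_map_compose[OF this locally_convex_topologyD(3)[OF assms(1)]]
  show ?thesis by (simp add: comp_def)
qed

lemma continuous_map_vector_sum:
  assumes T: "locally_convex_topology T" and "\<And>i. i \<in> I \<Longrightarrow> continuous_map X T (u i)"
  shows "continuous_map X T (\<lambda>z. \<Sum>i\<in>I. u i z)"
  using assms(2)
  by (induction I rule: infinite_finite_induct)
    (auto intro!: continuous_map_vector_add[OF T] simp: locally_convex_topologyD[OF T])

lemma continuous_dualD:
  assumes "\<phi> \<in> continuous_dual T"
  shows "linear \<phi>" "continuous_map T euclideanreal \<phi>"
  using assms by (auto simp: continuous_dual_def)

text \<open>A Schauder projection. As \<open>f\<close> need not factor through the functionals in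
  \<open>F\<close>, cube points are first sent into \<open>D\<close> by a partition of unity
  \<open>P\<close> over a finite net. A Brouwer fixed point \<open>y\<close> lists the normalised
  values at \<open>f (P y)\<close>, a point of \<open>D\<close>, and near such values
  \<open>P\<close> is accurate.\<close>

lemma approximate_weak_fixed_point:
  assumes T: "locally_convex_topology T" and D: "D \<noteq> {}" "convex D"
    and f: "continuous_map (subtopology T D) (subtopology T D) f"
    and F: "finite F" "F \<subseteq> continuous_dual T"
    and bounded: "\<And>\<phi>. \<phi> \<in> F \<Longrightarrow> bounded (\<phi> ` D)" and "e > 0"
  obtains x where "x \<in> D" "\<And>\<phi>. \<phi> \<in> F \<Longrightarrow> \<bar>\<phi> (x - f x)\<bar> < e"
proof -
  have top: "topspace T = UNIV" by (rule locally_convex_topologyD[OF T])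
  have "\<exists>b>0. \<forall>\<phi>\<in>F. \<forall>x\<in>D. \<bar>\<phi> x\<bar> \<le> b"
  proof -
    have "bounded (\<Union>\<phi>\<in>F. \<phi> ` D)" using F(1) bounded by (intro bounded_UN) auto
    then obtain b where "b > 0" "\<forall>y\<in>(\<Union>\<phi>\<in>F. \<phi> ` D). norm y \<le> b" using bounded_pos by metis
    then show ?thesis by auto
  qed
  then obtain b where b: "b > 0" "\<And>\<phi> x. \<phi> \<in> F \<Longrightarrow> x \<in> D \<Longrightarrow> \<bar>\<phi> x\<bar> \<le> b" by blast
  obtain \<psi> where \<psi>: "F = \<psi> ` {..<card F}"
    using ex_bij_betw_nat_finite[OF F(1)] unfolding bij_betw_def atLeast0LessThan by metis
  define n where "n = card F"
  define g where "g i x = (\<psi> i x / b + 1) / 2" for i :: nat and x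
  have \<psi>F: "\<psi> i \<in> F" if "i < n" for i using that \<psi> by (auto simp: n_def)
  have \<psi>_lin: "linear (\<psi> i)" and \<psi>_cont: "continuous_map T euclideanreal (\<psi> i)" if "i < n" for i
    using \<psi>F[OF that] F(2) continuous_dualD by blast+
  have g01: "0 \<le> g i x" "g i x \<le> 1" if "i < n" "x \<in> D" for i x
    using b(2)[OF \<psi>F[OF that(1)] that(2)] \<open>b > 0\<close> by (auto simp: g_def field_simps abs_le_iff)
  have fD: "f x \<in> D" if "x \<in> D" for x
    using continuous_map_image_subset_topspace[OF f] that top by auto
  \<comment> \<open>Undoing the normalisation in \<open>g\<close> multiplies errors by
    \<open>2 * b\<close>, which leaves \<open>e / 2\<close>.\<close>
  define \<eta> where "\<eta> = e / (4 * b)"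
  have "\<eta> > 0" using \<open>e > 0\<close> \<open>b > 0\<close> by (simp add: \<eta>_def)
  define d where "d y x = (\<Sum>i<n. \<bar>y i - g i x\<bar>)" for y :: "nat \<Rightarrow> real" and x
  obtain X where X: "finite X" "X \<subseteq> D" and net: "\<And>x. x \<in> D \<Longrightarrow> \<exists>x'\<in>X. d (\<lambda>i. g i x) x' \<le> \<eta> / 2"
  proof -
    \<comment> \<open>Pigeonhole: \<open>X\<close> will hold one representative for each occupied
      cell of mesh \<open>1 / N\<close>; the \<open>n\<close> coordinate errors then sum to at most
      \<open>\<eta> / 2\<close>.\<close>
    obtain N :: nat where N: "real n / \<eta> * 2 < real N" using reals_Archimedean2 by blast
    have "N > 0" using N \<open>\<eta> > 0\<close> by (cases N) (auto simp: divide_less_0_iff)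
    define c where "c x = restrict (\<lambda>i. \<lfloor>g i x * N\<rfloor>) {..<n}" for x
    have "c ` D \<subseteq> PiE {..<n} (\<lambda>_. {0..int N})"
    proof (intro image_subsetI PiE_I)
      fix x i assume x: "x \<in> D" "i \<in> {..<n}"
      then have "0 \<le> g i x * N" "g i x * N \<le> N" using g01[of i x] by (auto intro: mult_left_le_one_le)
      then show "c x i \<in> {0..int N}" using x(2) by (auto simp: c_def floor_le_iff)
    qed (auto simp: c_def)
    then have "finite (c ` D)" by (rule finite_subset) (auto intro: finite_PiE)
    then obtain X where X: "X \<subseteq> D" "finite X" "c ` D = c ` X" using finite_subset_image[of "c ` D" c D] by auto
    have "\<exists>x'\<in>X. d (\<lambda>i. g i x) x' \<le> \<eta> / 2" if x: "x \<in> D" for x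
    proof -
      obtain x' where x': "x' \<in> X" "c x = c x'" using X x by (metis imageE imageI)
      have "\<bar>g i x - g i x'\<bar> \<le> 1 / N" if i: "i < n" for i
      proof -
        have "\<lfloor>g i x * N\<rfloor> = \<lfloor>g i x' * N\<rfloor>" using fun_cong[OF x'(2), of i] i by (simp add: c_def)
        then have "\<bar>g i x * N - g i x' * N\<bar> \<le> 1" by linarith
        then have "\<bar>g i x - g i x'\<bar> * N \<le> 1" using abs_mult[of "g i x - g i x'" "real N"] by (simp add: left_diff_distrib)
        then show ?thesis using \<open>N > 0\<close> by (simp add: field_simps)
      qed
      then have "d (\<lambda>i. g i x) x' \<le> (\<Sum>i<n. 1 / N)" unfolding d_def by (intro sum_mono) auto
      also have "\<dots> \<le> \<eta> / 2" using N \<open>N > 0\<close> \<open>\<eta> > 0\<close> by (simp add: field_simps)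
      finally show ?thesis using x' by blast
    qed
    then show thesis using X that by blast
  qed
  obtain x0 where x0: "x0 \<in> X" using D(1) net by blast
  define \<sigma> where "\<sigma> y = (\<Sum>x\<in>X. max 0 (\<eta> - d y x))" for y
  \<comment> \<open>Far from the net all bumps vanish; the extra weight at \<open>x0\<close> keeps
    \<open>W y\<close> positive, so that \<open>P\<close> is defined and continuous everywhere. It
    is 0 once \<open>\<sigma> y \<ge> \<eta> / 2\<close>, as at the fixed point.\<close>
  define \<kappa> where "\<kappa> y x = max 0 (\<eta> - d y x) + (if x = x0 then max 0 (\<eta> / 2 - \<sigma> y) else 0)" for y x
  define W where "W y = \<sigma> y + max 0 (\<eta> / 2 - \<sigma> y)" for y
  define P where "P y = (\<Sum>x\<in>X. (\<kappa> y x / W y) *\<^sub>R x)" for y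
  have W: "W y > 0" "(\<Sum>x\<in>X. \<kappa> y x) = W y" for y
    using \<open>\<eta> > 0\<close> X(1) x0 by (auto simp: W_def \<kappa>_def sum.distrib \<sigma>_def)
  have wsum: "(\<Sum>x\<in>X. \<kappa> y x / W y) = 1" and wpos: "0 \<le> \<kappa> y x / W y" for y x
    using W[of y] by (auto simp: \<kappa>_def simp flip: sum_divide_distrib)
  have PD: "P y \<in> D" for y
    unfolding P_def using X D(2) wsum wpos by (intro convex_sum) auto
  have contd: "continuous_on UNIV (\<lambda>y. d y x)" for x
    unfolding d_def by (intro continuous_intros) auto
  have cont\<sigma>: "continuous_on UNIV \<sigma>"
    unfolding \<sigma>_def by (intro continuous_intros contd)
  have contw: "continuous_on UNIV (\<lambda>y. \<kappa> y x / W y)" for x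
  proof (intro continuous_on_divide ballI)
    show "continuous_on UNIV (\<lambda>y. \<kappa> y x)"
      unfolding \<kappa>_def by (cases "x = x0") (auto intro!: continuous_intros contd cont\<sigma>)
    show "continuous_on UNIV W" unfolding W_def by (intro continuous_intros cont\<sigma>)
    show "W y \<noteq> 0" for y using W(1)[of y] by simp
  qed
  have contP: "continuous_map euclidean (subtopology T D) P"
  proof -
    have "continuous_map euclidean T P"
      unfolding P_def using contw
      by (intro continuous_map_vector_sum[OF T] continuous_map_vector_scaleR[OF T])
        (auto simp: continuous_map_iff_continuous2 top)
    then show ?thesis using PD by (auto simp: continuous_map_in_subtopology)
  qed
  define h where "h y i = g i (f (P y))" for y i
  obtain y where y: "\<And>i. i < n \<Longrightarrow> h y i = y i"
  proof (rule brouwer_function_cube[of n h])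
    fix i assume i: "i < n"
    have "continuous_map (subtopology T D) euclideanreal (\<psi> i)"
      using \<psi>_cont[OF i] by (rule continuous_map_from_subtopology)
    then have "continuous_map euclidean euclideanreal (\<psi> i \<circ> (f \<circ> P))"
      using contP f by (intro continuous_map_compose)
    then have "continuous_on UNIV (\<lambda>y. \<psi> i (f (P y)))"
      by (simp add: continuous_map_iff_continuous2 comp_def)
    then show "continuous_on UNIV (\<lambda>y. h y i)"
      unfolding h_def g_def using \<open>b > 0\<close> by (intro continuous_intros) auto
    show "h y i \<in> {0..1}" for y using g01[OF i fD[OF PD]] by (auto simp: h_def)
  qed blast
  have dy: "d y x = d (\<lambda>i. g i (f (P y))) x" for x
    using y by (simp add: d_def h_def)
  have "\<sigma> y \<ge> \<eta> / 2"
  proof -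
    obtain x' where x': "x' \<in> X" "d y x' \<le> \<eta> / 2" using net[OF fD[OF PD]] dy by metis
    then have "\<eta> / 2 \<le> max 0 (\<eta> - d y x')" by (intro max.coboundedI2) simp
    also have "\<dots> \<le> \<sigma> y" unfolding \<sigma>_def using X(1) x'(1) by (intro member_le_sum) auto
    finally show ?thesis .
  qed
  then have lam: "\<kappa> y x = max 0 (\<eta> - d y x)" for x by (simp add: \<kappa>_def)
  have ws: "(\<Sum>x\<in>X. (\<kappa> y x / W y) * c) = c" for c
    using wsum[of y] by (simp only: mult_1 flip: sum_distrib_right)
  have close: "\<bar>g i (P y) - g i (f (P y))\<bar> \<le> \<eta>" if i: "i < n" for i
  proof -
    have gP: "g i (P y) = (\<Sum>x\<in>X. (\<kappa> y x / W y) * g i x)"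
    proof -
      have "\<psi> i (P y) = (\<Sum>x\<in>X. (\<kappa> y x / W y) * \<psi> i x)"
        unfolding P_def using \<psi>_lin[OF i] by (simp add: linear_sum linear_scale)
      moreover have "(\<Sum>x\<in>X. (\<kappa> y x / W y) * g i x) =
          (\<Sum>x\<in>X. (\<kappa> y x / W y) * \<psi> i x / (2 * b) + (\<kappa> y x / W y) * (1 / 2))"
        by (intro sum.cong) (simp_all add: g_def algebra_simps add_divide_distrib)
      ultimately show ?thesis
        using ws[of "1 / 2"] by (simp only: sum.distrib g_def add_divide_distrib flip: sum_divide_distrib) simp
    qed
    have "g i (P y) - y i = (\<Sum>x\<in>X. (\<kappa> y x / W y) * (g i x - y i))"
      by (simp only: gP right_diff_distrib sum_subtractf ws)
    also have "\<bar>\<dots>\<bar> \<le> (\<Sum>x\<in>X. \<bar>(\<kappa> y x / W y) * (g i x - y i)\<bar>)" by (rule sum_abs)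
    also have "\<dots> \<le> (\<Sum>x\<in>X. (\<kappa> y x / W y) * \<eta>)"
    proof (rule sum_mono)
      fix x assume "x \<in> X"
      show "\<bar>(\<kappa> y x / W y) * (g i x - y i)\<bar> \<le> (\<kappa> y x / W y) * \<eta>"
      proof (cases "\<kappa> y x = 0")
        case False
        then have "d y x \<le> \<eta>" by (simp add: lam max_def split: if_splits)
        moreover have "\<bar>y i - g i x\<bar> \<le> d y x" unfolding d_def using i by (intro member_le_sum) auto
        ultimately show ?thesis using wpos[of y x] unfolding abs_mult by (intro mult_mono) auto
      qed simp
    qed
    also have "\<dots> = \<eta>" by (rule ws)
    finally show ?thesis using y[OF i] by (simp add: h_def)
  qed
  have "\<bar>\<phi> (P y - f (P y))\<bar> < e" if \<phi>: "\<phi> \<in> F" for \<phi>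
  proof -
    obtain i where i: "i < n" "\<phi> = \<psi> i" using \<phi> \<psi> by (auto simp: n_def)
    have "\<phi> (P y - f (P y)) = 2 * b * (g i (P y) - g i (f (P y)))"
      using \<open>b > 0\<close> \<psi>_lin[OF i(1)] by (simp add: i(2) g_def linear_diff field_simps)
    then have "\<bar>\<phi> (P y - f (P y))\<bar> = 2 * b * \<bar>g i (P y) - g i (f (P y))\<bar>" using \<open>b > 0\<close> by (simp add: abs_mult)
    also have "\<dots> \<le> 2 * b * \<eta>" using close[OF i(1)] \<open>b > 0\<close> by simp
    also have "\<dots> < e" using \<open>b > 0\<close> \<open>e > 0\<close> by (simp add: \<eta>_def)
    finally show ?thesis .
  qed
  then show thesis using that PD by blast
qed

section \<open>The Hahn-Banach theorem\<close>

definition sublinear :: "('a::real_vector \<Rightarrow> real) \<Rightarrow> bool" where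
  "sublinear p \<longleftrightarrow> (\<forall>x y. p (x + y) \<le> p x + p y) \<and> (\<forall>c>0. \<forall>x. p (c *\<^sub>R x) \<le> c * p x)"

lemma sublinearD:
  assumes "sublinear p"
  shows "p (x + y) \<le> p x + p y" "c > 0 \<Longrightarrow> p (c *\<^sub>R x) \<le> c * p x"
  using assms by (auto simp: sublinear_def)

lemma sublinear_0: "sublinear p \<Longrightarrow> p 0 = 0"
  using sublinearD(1)[of p 0 0] sublinearD(2)[of p "1/2" 0] by simp

lemma sublinear_scaleR:
  assumes p: "sublinear p" and "c \<ge> 0"
  shows "p (c *\<^sub>R x) = c * p x"
proof (cases "c = 0")
  case False
  then have c: "c > 0" using assms by simp
  have "p (inverse c *\<^sub>R (c *\<^sub>R x)) \<le> inverse c * p (c *\<^sub>R x)"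
    using c by (intro sublinearD(2)[OF p]) simp
  then have "c * p x \<le> p (c *\<^sub>R x)" using c by (simp add: field_simps)
  then show ?thesis using sublinearD(2)[OF p c, of x] by simp
qed (simp add: sublinear_0[OF p])

lemma sublinear_minus: "sublinear p \<Longrightarrow> - p (- x) \<le> p x"
  using sublinearD(1)[of p x "- x"] sublinear_0[of p] by simp

text \<open>A pair \<open>(w, d)\<close> encodes the demand \<open>d \<le> f w\<close>. A linear
  \<open>f\<close> lies below \<open>q\<close> exactly if it lies below \<open>p\<close> and meets
  all demands; the infimum is bounded below by \<open>- p (- z)\<close>.\<close>

lemma sublinear_cone_Inf:
  fixes p :: "'a::real_vector \<Rightarrow> real" and A :: "('a \<times> real) set"
  assumes p: "sublinear p" and cone: "convex_cone A" and le: "\<forall>(w, d)\<in>A. d \<le> p w"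
  defines "q \<equiv> \<lambda>z. INF a\<in>A. p (z + fst a) - snd a"
  shows "sublinear q" "q z \<le> p z" "(w, d) \<in> A \<Longrightarrow> q z \<le> p (z + w) - d"
proof -
  have A0: "(0, 0) \<in> A" using convex_cone_contains_0[OF cone] by (simp add: zero_prod_def)
  note add = convex_cone_add[OF cone] and scale = convex_cone_scaleR[OF cone]
  have bdd: "bdd_below ((\<lambda>a. p (z + fst a) - snd a) ` A)" for z
  proof (rule bdd_belowI2)
    fix a assume "a \<in> A"
    then have "snd a \<le> p (fst a)" using le by auto
    also have "\<dots> \<le> p (z + fst a) + p (- z)" using sublinearD(1)[OF p, of "z + fst a" "- z"] by simp
    finally show "- p (- z) \<le> p (z + fst a) - snd a" by simp
  qed
  have low: "q z \<le> p (z + fst a) - snd a" if "a \<in> A" for z a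
    unfolding q_def using bdd that by (rule cINF_lower)
  have gr: "m \<le> q z" if "\<And>a. a \<in> A \<Longrightarrow> m \<le> p (z + fst a) - snd a" for m z
    unfolding q_def using A0 that by (intro cINF_greatest) auto
  show "(w, d) \<in> A \<Longrightarrow> q z \<le> p (z + w) - d" using low[of "(w, d)"] by simp
  show "q z \<le> p z" using low[OF A0, of z] by simp
  show "sublinear q"
    unfolding sublinear_def
  proof (intro conjI allI impI)
    fix x y
    have *: "q (x + y) \<le> (p (x + fst a) - snd a) + (p (y + fst b) - snd b)" if "a \<in> A" "b \<in> A" for a b
    proof -
      have "q (x + y) \<le> p ((x + fst a) + (y + fst b)) - snd (a + b)"
        using low[OF add[OF that], of "x + y"] by (simp add: algebra_simps)
      also have "\<dots> \<le> p (x + fst a) + p (y + fst b) - snd (a + b)" using sublinearD(1)[OF p] by simp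
      finally show ?thesis by simp
    qed
    have "q (x + y) - (p (x + fst a) - snd a) \<le> q y" if "a \<in> A" for a
      using *[OF that] by (intro gr) (simp add: algebra_simps)
    then have "q (x + y) - q y \<le> q x"
      by (intro gr) (simp add: algebra_simps)
    then show "q (x + y) \<le> q x + q y" by simp
  next
    fix c :: real and x assume c: "c > 0"
    have "q (c *\<^sub>R x) / c \<le> q x"
    proof (rule gr)
      fix a assume "a \<in> A"
      have "q (c *\<^sub>R x) \<le> p (c *\<^sub>R (x + fst a)) - c * snd a"
        using low[OF scale[OF less_imp_le[OF c] \<open>a \<in> A\<close>], of "c *\<^sub>R x"] by (simp add: algebra_simps)
      also have "\<dots> = c * (p (x + fst a) - snd a)"
        using sublinear_scaleR[OF p, of c "x + fst a"] c by (simp add: right_diff_distrib)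
      finally show "q (c *\<^sub>R x) / c \<le> p (x + fst a) - snd a" using c by (simp add: field_simps)
    qed
    then show "q (c *\<^sub>R x) \<le> c * q x" using c by (simp add: field_simps)
  qed
qed

text \<open>Imposing the demand \<open>q y\<close> at \<open>y\<close> (the ray \<open>A\<close>)
  can only lower \<open>q\<close>, so by minimality it changes nothing; this is
  superadditivity.\<close>

lemma minimal_sublinear_imp_linear:
  fixes q :: "'a::real_vector \<Rightarrow> real"
  assumes q: "sublinear q" and min: "\<And>r. sublinear r \<Longrightarrow> r \<le> q \<Longrightarrow> r = q"
  shows "linear q"
proof -
  have ge: "q z + q y \<le> q (z + y)" for z y
  proof -
    define A where "A = {(s *\<^sub>R y, s * q y) | s. s \<ge> 0}"
    have 1: "convex_cone A"
      unfolding convex_cone_iff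
    proof (intro conjI ballI allI impI)
      show "0 \<in> A" unfolding A_def by (intro CollectI exI[of _ 0]) (simp add: zero_prod_def)
    next
      fix a b assume ab: "a \<in> A" "b \<in> A"
      obtain s t where "a = (s *\<^sub>R y, s * q y)" "s \<ge> 0" "b = (t *\<^sub>R y, t * q y)" "t \<ge> 0"
        using ab by (auto simp: A_def)
      then show "a + b \<in> A" unfolding A_def by (intro CollectI exI[of _ "s + t"]) (simp add: algebra_simps)
    next
      fix a and c :: real assume ca: "c \<ge> 0" "a \<in> A"
      obtain s where "a = (s *\<^sub>R y, s * q y)" "s \<ge> 0" using ca(2) by (auto simp: A_def)
      then show "c *\<^sub>R a \<in> A" using ca(1) unfolding A_def by (intro CollectI exI[of _ "c * s"]) simp
    qed
    have 2: "\<forall>(w, d)\<in>A. d \<le> q w"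
      using sublinear_scaleR[OF q] by (auto simp: A_def)
    note R = sublinear_cone_Inf[OF q 1 2]
    have eq: "(\<lambda>z. INF a\<in>A. q (z + fst a) - snd a) = q"
    proof (rule min)
      show "(\<lambda>z. INF a\<in>A. q (z + fst a) - snd a) \<le> q" using R(2) by (auto intro: le_funI)
    qed (rule R(1))
    have "(y, q y) \<in> A" unfolding A_def by (intro CollectI exI[of _ 1]) simp
    from R(3)[OF this, of z] fun_cong[OF eq, of z] show ?thesis by simp
  qed
  have add: "q (x + y) = q x + q y" for x y using ge[of x y] sublinearD(1)[OF q, of x y] by simp
  have neg: "q (- x) = - q x" for x using add[of x "- x"] sublinear_0[OF q] by simp
  have "q (c *\<^sub>R x) = c * q x" for c x
    using sublinear_scaleR[OF q, of c x] sublinear_scaleR[OF q, of "- c" x] neg[of "c *\<^sub>R x"]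
    by (cases "c \<ge> 0") auto
  with add show ?thesis by (intro linearI) auto
qed

lemma linear_below_sublinear:
  fixes p :: "'a::real_vector \<Rightarrow> real"
  assumes p: "sublinear p"
  obtains f where "linear f" "\<And>x. f x \<le> p x"
proof -
  define \<A> where "\<A> = {q. sublinear q \<and> q \<le> p}"
  \<comment> \<open>The order is reversed, so that Zorn's lemma yields a minimal element.\<close>
  define R where "R = (\<lambda>f g :: 'a \<Rightarrow> real. g \<le> f)"
  have "\<exists>m\<in>\<A>. \<forall>a\<in>\<A>. R m a \<longrightarrow> a = m"
  proof (rule predicate_Zorn)
    show "partial_order_on \<A> (relation_of R \<A>)"
      by (rule partial_order_on_relation_ofI) (auto simp: R_def)
    fix C assume "C \<in> Chains (relation_of R \<A>)"
    then have sub: "C \<subseteq> \<A>" and lin: "\<And>f g. f \<in> C \<Longrightarrow> g \<in> C \<Longrightarrow> f \<le> g \<or> g \<le> f"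
      by (auto simp: Chains_def relation_of_def R_def)
    show "\<exists>u\<in>\<A>. \<forall>a\<in>C. R a u"
    proof (cases "C = {}")
      case True
      then show ?thesis using p by (auto simp: \<A>_def)
    next
      case False
      define u where "u x = (INF f\<in>C. f x)" for x
      have bdd: "bdd_below ((\<lambda>f. f x) ` C)" for x
      proof (rule bdd_belowI2)
        fix f assume "f \<in> C"
        then have f: "sublinear f" "f (- x) \<le> p (- x)" using sub by (auto simp: \<A>_def le_fun_def)
        show "- p (- x) \<le> f x" using sublinear_minus[OF f(1), of x] f(2) by simp
      qed
      have low: "u x \<le> f x" if "f \<in> C" for f x unfolding u_def using bdd that by (rule cINF_lower)
      have gr: "m \<le> u x" if "\<And>f. f \<in> C \<Longrightarrow> m \<le> f x" for m x
        unfolding u_def using False that by (intro cINF_greatest) auto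
      have "sublinear u"
        unfolding sublinear_def
      proof (intro conjI allI impI)
        fix x y
        have *: "u (x + y) \<le> f x + g y" if fg: "f \<in> C" "g \<in> C" for f g
        proof -
          obtain h where h: "h \<in> C" "h \<le> f" "h \<le> g" using lin[OF fg] fg by blast
          have "u (x + y) \<le> h (x + y)" using low h by simp
          also have "\<dots> \<le> h x + h y" using h sub by (auto simp: \<A>_def intro: sublinearD)
          also have "\<dots> \<le> f x + g y" using h by (auto simp: le_fun_def intro: add_mono)
          finally show ?thesis .
        qed
        have "u (x + y) - f x \<le> u y" if "f \<in> C" for f
          using *[OF that] by (intro gr) (simp add: algebra_simps)
        then have "u (x + y) - u y \<le> u x" by (intro gr) (simp add: algebra_simps)
        then show "u (x + y) \<le> u x + u y" by simp
      next
        fix c :: real and x assume c: "c > 0"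
        have "u (c *\<^sub>R x) / c \<le> u x"
        proof (rule gr)
          fix f assume "f \<in> C"
          then have "u (c *\<^sub>R x) \<le> f (c *\<^sub>R x)" by (rule low)
          also have "\<dots> \<le> c * f x" using sub \<open>f \<in> C\<close> c by (auto simp: \<A>_def intro: sublinearD)
          finally show "u (c *\<^sub>R x) / c \<le> f x" using c by (simp add: field_simps)
        qed
        then show "u (c *\<^sub>R x) \<le> c * u x" using c by (simp add: field_simps)
      qed
      moreover have "u \<le> p"
      proof -
        obtain f where f: "f \<in> C" using False by blast
        have "u \<le> f" using low[OF f] by (rule le_funI)
        also have "f \<le> p" using f sub by (auto simp: \<A>_def)
        finally show ?thesis .
      qed
      ultimately show ?thesis using low by (intro bexI[of _ u]) (auto simp: \<A>_def R_def le_fun_def)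
    qed
  qed
  then obtain q where q: "sublinear q" "q \<le> p" and min: "\<And>r. sublinear r \<Longrightarrow> r \<le> p \<Longrightarrow> r \<le> q \<Longrightarrow> r = q"
    by (auto simp: \<A>_def R_def)
  have "linear q"
    using q(1)
  proof (rule minimal_sublinear_imp_linear)
    fix r assume "sublinear r" "r \<le> q"
    then show "r = q" using min[of r] q(2) order_trans by blast
  qed
  then show thesis using that q(2) by (auto simp: le_fun_def)
qed

text \<open>One form for extension and separation: a cone that is a subspace prescribes values, and
  a cone generated by a convex set of demands separates.\<close>

theorem Mazur_Orlicz_cone:
  fixes p :: "'a::real_vector \<Rightarrow> real" and A :: "('a \<times> real) set"
  assumes "sublinear p" "convex_cone A" "\<forall>(w, d)\<in>A. d \<le> p w"
  obtains f where "linear f" "\<And>x. f x \<le> p x" "\<And>w d. (w, d) \<in> A \<Longrightarrow> d \<le> f w"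
proof -
  note R = sublinear_cone_Inf[OF assms]
  obtain f where f: "linear f" "\<And>x. f x \<le> (INF a\<in>A. p (x + fst a) - snd a)"
    using linear_below_sublinear[OF R(1)] by blast
  show thesis
  proof
    show "f x \<le> p x" for x using f(2) R(2) by (rule order_trans)
    show "d \<le> f w" if "(w, d) \<in> A" for w d
    proof -
      have "f (- w) \<le> p (- w + w) - d" using f(2) R(3)[OF that] by (rule order_trans)
      then show ?thesis using sublinear_0[OF assms(1)] linear_neg[OF f(1)] by simp
    qed
  qed (rule f)
qed

section \<open>Polars and their seminorms\<close>

text \<open>Linearity is a pointwise closed condition, which gives compactness; continuity is
  automatic for open neighbourhoods of 0 (\<open>real_polar_subset_dual\<close>).\<close>

definition real_polar :: "'a::real_vector set \<Rightarrow> ('a \<Rightarrow> real) set" where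
  "real_polar U = {\<phi>. linear \<phi> \<and> (\<forall>x\<in>U. \<bar>\<phi> x\<bar> \<le> 1)}"

text \<open>The gauge of the absolute bipolar of \<open>U\<close>; since the polar is symmetric, the
  supremum already accounts for absolute values.\<close>

definition polar_seminorm :: "'a::real_vector set \<Rightarrow> 'a \<Rightarrow> real" where
  "polar_seminorm U z = (SUP \<phi>\<in>real_polar U. \<phi> z)"

definition absorbing :: "'a::real_vector set \<Rightarrow> bool" where
  "absorbing U \<longleftrightarrow> (\<forall>x. \<exists>s>0. s *\<^sub>R x \<in> U)"

lemma real_polar_antimono: "V \<subseteq> U \<Longrightarrow> real_polar U \<subseteq> real_polar V"
  by (auto simp: real_polar_def)

lemma zero_in_real_polar: "(\<lambda>_. 0) \<in> real_polar U"
  by (auto simp: real_polar_def intro: linear_zero)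

lemma uminus_in_real_polar: "\<phi> \<in> real_polar U \<Longrightarrow> (\<lambda>x. - \<phi> x) \<in> real_polar U"
  by (auto simp: real_polar_def intro: linear_compose_neg)

lemma real_polar_pointwise_bounded:
  assumes "absorbing U"
  obtains B where "\<And>\<phi>. \<phi> \<in> real_polar U \<Longrightarrow> \<bar>\<phi> x\<bar> \<le> B"
proof -
  obtain s where s: "s > 0" "s *\<^sub>R x \<in> U" using assms by (auto simp: absorbing_def)
  have "\<bar>\<phi> x\<bar> \<le> 1 / s" if "\<phi> \<in> real_polar U" for \<phi>
  proof -
    have "linear \<phi>" "\<bar>\<phi> (s *\<^sub>R x)\<bar> \<le> 1" using that s(2) by (auto simp: real_polar_def)
    then have "s * \<bar>\<phi> x\<bar> \<le> 1" using s(1) by (simp add: linear_scale abs_mult)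
    then show ?thesis using s(1) by (simp add: field_simps)
  qed
  then show thesis by (rule that)
qed

text \<open>Banach-Alaoglu: linearity and the bounds on \<open>U\<close> cut a closed set out of a
  product of intervals.\<close>

lemma compact_real_polar:
  assumes "absorbing U"
  shows "compact (real_polar U)"
proof -
  have "\<forall>x. \<exists>B. \<forall>\<phi>\<in>real_polar U. \<bar>\<phi> x\<bar> \<le> B"
    using real_polar_pointwise_bounded[OF assms] by metis
  from choice[OF this] obtain B where B: "\<And>x \<phi>. \<phi> \<in> real_polar U \<Longrightarrow> \<bar>\<phi> x\<bar> \<le> B x" by blast
  have comp: "compact {\<phi>. \<forall>x. \<phi> x \<in> {- B x..B x}}" by (rule compact_functions) simp
  have cont: "continuous_on UNIV (\<lambda>\<phi> :: 'a \<Rightarrow> real. \<phi> x)" for x by simp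
  have "real_polar U = (\<Inter>x y. {\<phi>. \<phi> (x + y) = \<phi> x + \<phi> y}) \<inter> (\<Inter>c x. {\<phi>. \<phi> (c *\<^sub>R x) = c * \<phi> x}) \<inter>
      (\<Inter>x\<in>U. {\<phi>. \<bar>\<phi> x\<bar> \<le> 1})"
    by (auto simp: real_polar_def linear_iff)
  also have "closed \<dots>"
    by (intro closed_Int closed_INT ballI closed_Collect_eq closed_Collect_le continuous_intros cont)
  finally have "closed (real_polar U)" .
  moreover have "real_polar U \<subseteq> {\<phi>. \<forall>x. \<phi> x \<in> {- B x..B x}}"
    using B by (auto simp: abs_le_iff minus_le_iff)
  ultimately show ?thesis using comp compact_Int_closed by (metis inf.absorb_iff2)
qed

lemma openin_absorbing:
  assumes T: "locally_convex_topology T" and U: "openin T U" "0 \<in> U"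
  shows "absorbing U"
  unfolding absorbing_def
proof
  fix x :: 'a
  have "continuous_map euclideanreal T (\<lambda>r. r *\<^sub>R x)"
    by (intro continuous_map_vector_scaleR[OF T]) (simp_all add: locally_convex_topologyD[OF T])
  then have "openin euclideanreal {r \<in> topspace euclideanreal. r *\<^sub>R x \<in> U}"
    using U(1) by (rule openin_continuous_map_preimage)
  then have "open {r. r *\<^sub>R x \<in> U}" by simp
  then obtain e where "e > 0" "ball 0 e \<subseteq> {r. r *\<^sub>R x \<in> U}"
    using U(2) by (metis (mono_tags, lifting) mem_Collect_eq openE scaleR_zero_left)
  then show "\<exists>s>0. s *\<^sub>R x \<in> U" by (intro exI[of _ "e / 2"]) (auto simp: subset_iff)
qed

lemma real_polar_subset_dual:
  assumes T: "locally_convex_topology T" and U: "openin T U" "0 \<in> U"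
  shows "real_polar U \<subseteq> continuous_dual T"
proof
  fix \<phi> assume "\<phi> \<in> real_polar U"
  then have lin: "linear \<phi>" and le: "\<And>x. x \<in> U \<Longrightarrow> \<bar>\<phi> x\<bar> \<le> 1" by (auto simp: real_polar_def)
  note top = locally_convex_topologyD(1)[OF T]
  have "openin T {x \<in> topspace T. \<phi> x \<in> W}" if W: "open W" for W
  proof (subst openin_subopen, intro ballI)
    fix x assume "x \<in> {x \<in> topspace T. \<phi> x \<in> W}"
    then have "\<phi> x \<in> W" by simp
    with W obtain e where e: "e > 0" "ball (\<phi> x) e \<subseteq> W" by (meson openE)
    \<comment> \<open>The factor \<open>2 / e\<close> yields a difference of at most
      \<open>e / 2\<close>, hence strictly below \<open>e\<close>.\<close>
    define V where "V = {z \<in> topspace T. (2 / e) *\<^sub>R (z + (- x)) \<in> U}"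
    have "continuous_map T T (\<lambda>z. (2 / e) *\<^sub>R (z + (- x)))"
      by (intro continuous_map_vector_scaleR[OF T] continuous_map_vector_add[OF T]) (simp_all add: top)
    then have "openin T V" unfolding V_def using U(1) by (rule openin_continuous_map_preimage)
    moreover have "x \<in> V" using U(2) by (simp add: V_def top)
    moreover have "V \<subseteq> {x \<in> topspace T. \<phi> x \<in> W}"
    proof
      fix z assume "z \<in> V"
      then have "\<bar>\<phi> ((2 / e) *\<^sub>R (z + (- x)))\<bar> \<le> 1" using le by (simp add: V_def)
      moreover have "\<phi> ((2 / e) *\<^sub>R (z + (- x))) = (2 / e) * (\<phi> z - \<phi> x)"
        by (simp add: linear_scale[OF lin] linear_diff[OF lin])
      ultimately have "\<bar>2 / e * (\<phi> z - \<phi> x)\<bar> \<le> 1" by (simp only:)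
      then have "2 / e * \<bar>\<phi> z - \<phi> x\<bar> \<le> 1" unfolding abs_mult using e(1) by simp
      then have "\<bar>\<phi> z - \<phi> x\<bar> < e" using e(1) by (simp add: field_simps)
      then have "\<phi> z \<in> ball (\<phi> x) e" using e(1) by (simp add: dist_real_def abs_minus_commute)
      then show "z \<in> {x \<in> topspace T. \<phi> x \<in> W}" using e(2) by (auto simp: top)
    qed
    ultimately show "\<exists>S. openin T S \<and> x \<in> S \<and> S \<subseteq> {x \<in> topspace T. \<phi> x \<in> W}" by blast
  qed
  then have "continuous_map T euclideanreal \<phi>" by (simp add: continuous_map_def)
  then show "\<phi> \<in> continuous_dual T" using lin by (simp add: continuous_dual_def)
qed

text \<open>Continuity at 0 bounds each functional by 1 on some metric ball around 0. The metric
  enters only here; what is kept of it is the increasing sequence of compact polars.\<close>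

lemma metrizable_dual_exhaustion:
  fixes T :: "'a::real_vector topology"
  assumes T: "locally_convex_topology T" and "metrizable_space T"
  obtains U :: "nat \<Rightarrow> 'a set" where "\<And>m. absorbing (U m)" "incseq (\<lambda>m. real_polar (U m))"
    "continuous_dual T = (\<Union>m. real_polar (U m))"
proof -
  note top = locally_convex_topologyD(1)[OF T]
  obtain M d where "Metric_space M d" and Td: "T = Metric_space.mtopology M d"
    using assms(2) by (auto simp: metrizable_space_def)
  interpret Metric_space M d by fact
  have M: "M = UNIV" using top Td by simp
  define U where "U m = mball 0 (1 / Suc m)" for m
  have U: "openin T (U m)" "0 \<in> U m" for m
    using openin_mball centre_in_mball_iff[of 0 "1 / Suc m"] M unfolding U_def Td by auto
  show thesis
  proof
    show "absorbing (U m)" for m using openin_absorbing[OF T U] .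
    show "incseq (\<lambda>m. real_polar (U m))"
      unfolding incseq_def U_def
      by (intro allI impI real_polar_antimono mball_subset_concentric divide_left_mono) auto
    show "continuous_dual T = (\<Union>m. real_polar (U m))"
    proof
      show "(\<Union>m. real_polar (U m)) \<subseteq> continuous_dual T"
        using real_polar_subset_dual[OF T U] by blast
      show "continuous_dual T \<subseteq> (\<Union>m. real_polar (U m))"
      proof
        fix \<phi> assume \<phi>: "\<phi> \<in> continuous_dual T"
        then have "openin T {x \<in> topspace T. \<phi> x \<in> ball 0 1}"
          by (intro openin_continuous_map_preimage[OF continuous_dualD(2)[OF \<phi>]]) simp
        moreover have "0 \<in> {x \<in> topspace T. \<phi> x \<in> ball 0 1}"
          using linear_0[OF continuous_dualD(1)[OF \<phi>]] by (simp add: top)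
        ultimately obtain r where r: "r > 0" "mball 0 r \<subseteq> {x \<in> topspace T. \<phi> x \<in> ball 0 1}"
          unfolding Td openin_mtopology by blast
        obtain m :: nat where "1 / Suc m < r" using r(1) nat_approx_posE by blast
        then have "U m \<subseteq> {x \<in> topspace T. \<phi> x \<in> ball 0 1}"
          using r(2) mball_subset_concentric[of "1 / Suc m" r 0] by (auto simp: U_def)
        then have "\<phi> \<in> real_polar (U m)"
          using continuous_dualD(1)[OF \<phi>] by (auto simp: real_polar_def less_imp_le subset_iff)
        then show "\<phi> \<in> (\<Union>m. real_polar (U m))" by blast
      qed
    qed
  qed
qed

lemma continuous_dual_bounded:
  assumes T: "locally_convex_topology T" and "tvs_bounded T C" and \<phi>: "\<phi> \<in> continuous_dual T"
  shows "bounded (\<phi> ` C)"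
proof -
  note lin = continuous_dualD(1)[OF \<phi>]
  have "openin T {x \<in> topspace T. \<phi> x \<in> ball 0 1}"
    by (intro openin_continuous_map_preimage[OF continuous_dualD(2)[OF \<phi>]]) simp
  moreover have "0 \<in> {x \<in> topspace T. \<phi> x \<in> ball 0 1}"
    using linear_0[OF lin] by (simp add: locally_convex_topologyD[OF T])
  ultimately obtain s where s: "s > 0" "\<forall>t>s. C \<subseteq> (\<lambda>x. t *\<^sub>R x) ` {x \<in> topspace T. \<phi> x \<in> ball 0 1}"
    using assms(2) unfolding tvs_bounded_def by blast
  have "\<bar>\<phi> x\<bar> \<le> s + 1" if "x \<in> C" for x
  proof -
    have "x \<in> (\<lambda>x. (s + 1) *\<^sub>R x) ` {x \<in> topspace T. \<phi> x \<in> ball 0 1}" using s(2) that by force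
    then obtain z where "x = (s + 1) *\<^sub>R z" "\<bar>\<phi> z\<bar> < 1" by auto
    then show ?thesis using s(1) by (simp add: linear_scale[OF lin] abs_mult mult_left_le)
  qed
  then show ?thesis by (auto simp: bounded_iff)
qed

section \<open>The seminorm of a polar: dominated functionals and closures of convex sets\<close>

context
  fixes U :: "'a::real_vector set"
  assumes U: "absorbing U"
begin

lemma polar_le_seminorm:
  assumes "\<phi> \<in> real_polar U"
  shows "\<phi> z \<le> polar_seminorm U z"
proof -
  obtain B where "\<And>\<phi>. \<phi> \<in> real_polar U \<Longrightarrow> \<bar>\<phi> z\<bar> \<le> B" using real_polar_pointwise_bounded[OF U] by blast
  then have "bdd_above ((\<lambda>\<phi>. \<phi> z) ` real_polar U)" by (intro bdd_aboveI2[of _ _ B]) (auto simp: abs_le_iff)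
  then show ?thesis unfolding polar_seminorm_def using assms by (intro cSUP_upper)
qed

lemma polar_seminorm_le:
  assumes "\<And>\<phi>. \<phi> \<in> real_polar U \<Longrightarrow> \<phi> z \<le> B"
  shows "polar_seminorm U z \<le> B"
  unfolding polar_seminorm_def using zero_in_real_polar assms by (intro cSUP_least) auto

lemma sublinear_polar_seminorm: "sublinear (polar_seminorm U)"
  unfolding sublinear_def
proof (intro conjI allI impI)
  fix x y show "polar_seminorm U (x + y) \<le> polar_seminorm U x + polar_seminorm U y"
    by (rule polar_seminorm_le)
      (auto simp: real_polar_def linear_add intro!: add_mono polar_le_seminorm)
next
  fix c :: real and x assume "c > 0"
  then show "polar_seminorm U (c *\<^sub>R x) \<le> c * polar_seminorm U x"
    by (intro polar_seminorm_le)
      (auto simp: real_polar_def linear_scale intro!: mult_left_mono polar_le_seminorm)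
qed

lemma polar_seminorm_minus: "polar_seminorm U (- z) = polar_seminorm U z"
proof -
  have "polar_seminorm U (- z) \<le> polar_seminorm U z" for z
  proof (rule polar_seminorm_le)
    fix \<phi> assume \<phi>: "\<phi> \<in> real_polar U"
    then have "\<phi> (- z) = - \<phi> z" by (simp add: real_polar_def linear_neg)
    then show "\<phi> (- z) \<le> polar_seminorm U z" using polar_le_seminorm[OF uminus_in_real_polar[OF \<phi>]] by simp
  qed
  from this[of z] this[of "- z"] show ?thesis by simp
qed

lemma polar_seminorm_le_1: "z \<in> U \<Longrightarrow> polar_seminorm U z \<le> 1"
  by (rule polar_seminorm_le) (auto simp: real_polar_def abs_le_iff)

lemma below_seminorm_abs_le:
  assumes "linear f" "\<And>z. f z \<le> c * polar_seminorm U z"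
  shows "\<bar>f z\<bar> \<le> c * polar_seminorm U z"
  using assms(2)[of z] assms(2)[of "- z"] linear_neg[OF assms(1)] by (simp add: polar_seminorm_minus abs_le_iff)

text \<open>Up to the factor \<open>c\<close>, a dominated functional belongs to the polar. Hence
  Hahn-Banach functionals for the seminorm of one polar are continuous for every topology whose dual
  contains that polar.\<close>

lemma below_seminorm_in_dual:
  assumes "real_polar U \<subseteq> continuous_dual T"
    and lin: "linear f" and le: "\<And>z. f z \<le> c * polar_seminorm U z" and "c > 0"
  shows "f \<in> continuous_dual T"
proof -
  have "\<bar>f z\<bar> \<le> c" if "z \<in> U" for z
    using order_trans[OF below_seminorm_abs_le[OF lin le] mult_left_mono[OF polar_seminorm_le_1[OF that]]] \<open>c > 0\<close>
    by simp
  then have "(\<lambda>z. f z / c) \<in> real_polar U"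
    using \<open>c > 0\<close> lin by (auto simp: real_polar_def linear_iff add_divide_distrib)
  then have "continuous_map T euclideanreal (\<lambda>z. f z / c)" using assms(1) continuous_dualD by blast
  from continuous_map_real_mult_left[OF this, of c]
  have "continuous_map T euclideanreal f" using \<open>c > 0\<close> by simp
  then show ?thesis using lin by (simp add: continuous_dual_def)
qed

definition seminorm_closure :: "'a set \<Rightarrow> 'a set" where
  "seminorm_closure H = {z. \<forall>\<delta>>0. \<exists>u\<in>H. polar_seminorm U (z - u) < \<delta>}"

lemma subset_seminorm_closure: "H \<subseteq> seminorm_closure H"
  using sublinear_0[OF sublinear_polar_seminorm] unfolding seminorm_closure_def by force

lemma convex_seminorm_closure:
  assumes "convex H"
  shows "convex (seminorm_closure H)"
proof (rule convexI)
  fix x y and s t :: real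
  assume xy: "x \<in> seminorm_closure H" "y \<in> seminorm_closure H" and st: "0 \<le> s" "0 \<le> t" "s + t = 1"
  show "s *\<^sub>R x + t *\<^sub>R y \<in> seminorm_closure H"
    unfolding seminorm_closure_def
  proof (intro CollectI allI impI)
    fix \<delta> :: real assume "\<delta> > 0"
    then obtain u v where u: "u \<in> H" "polar_seminorm U (x - u) < \<delta>" and v: "v \<in> H" "polar_seminorm U (y - v) < \<delta>"
      using xy unfolding seminorm_closure_def by blast
    have "polar_seminorm U ((s *\<^sub>R x + t *\<^sub>R y) - (s *\<^sub>R u + t *\<^sub>R v)) = polar_seminorm U (s *\<^sub>R (x - u) + t *\<^sub>R (y - v))"
      by (simp add: algebra_simps)
    also have "\<dots> \<le> s * polar_seminorm U (x - u) + t * polar_seminorm U (y - v)"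
      using sublinearD(1)[OF sublinear_polar_seminorm] sublinear_scaleR[OF sublinear_polar_seminorm] st by metis
    also have "\<dots> < \<delta>" using u(2) v(2) st by (rule convex_bound_lt)
    finally show "\<exists>u\<in>H. polar_seminorm U ((s *\<^sub>R x + t *\<^sub>R y) - u) < \<delta>"
      using convexD[OF assms u(1) v(1) st] by blast
  qed
qed

text \<open>Mazur's theorem: convex closures do not depend on the topology but only on the dual.\<close>

lemma closedin_seminorm_closure:
  assumes T: "locally_convex_topology T" and dual: "real_polar U \<subseteq> continuous_dual T" and H: "convex H"
  shows "closedin T (seminorm_closure H)"
  unfolding closedin_def
proof
  note top = locally_convex_topologyD(1)[OF T]
  note p = sublinear_polar_seminorm
  show "seminorm_closure H \<subseteq> topspace T" by (simp add: top)
  show "openin T (topspace T - seminorm_closure H)"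
  proof (subst openin_subopen, intro ballI)
    fix x assume "x \<in> topspace T - seminorm_closure H"
    then obtain \<delta> where \<delta>: "\<delta> > 0" "\<And>u. u \<in> H \<Longrightarrow> \<delta> \<le> polar_seminorm U (x - u)"
      by (auto simp: seminorm_closure_def not_less)
    \<comment> \<open>The demands \<open>\<delta> \<le> f (x - u)\<close> for \<open>u\<close> in
      \<open>H\<close>, closed up to a convex cone: the resulting functional separates
      \<open>x\<close> from \<open>H\<close> and stays below the seminorm.\<close>
    define A where "A = {(0, 0)} \<union> {(s *\<^sub>R (x - u), s * \<delta>) | s u. s > 0 \<and> u \<in> H}"
    have AI: "(s *\<^sub>R (x - u), s * \<delta>) \<in> A" if "s > 0" "u \<in> H" for s u using that by (auto simp: A_def)
    have "convex_cone A"
      unfolding convex_cone_iff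
    proof (intro conjI ballI allI impI)
      show "0 \<in> A" by (simp add: A_def zero_prod_def)
    next
      fix a b assume ab: "a \<in> A" "b \<in> A"
      show "a + b \<in> A"
      proof (cases "a = 0 \<or> b = 0")
        case False
        then obtain s u t v where a: "a = (s *\<^sub>R (x - u), s * \<delta>)" "s > 0" "u \<in> H"
          and b: "b = (t *\<^sub>R (x - v), t * \<delta>)" "t > 0" "v \<in> H"
          using ab by (auto simp: A_def zero_prod_def)
        define c where "c = (s / (s + t)) *\<^sub>R u + (t / (s + t)) *\<^sub>R v"
        have c: "c \<in> H" unfolding c_def using a b by (intro convexD[OF H]) (auto simp flip: add_divide_distrib)
        have "(s + t) *\<^sub>R c = s *\<^sub>R u + t *\<^sub>R v" using a(2) b(2) by (simp add: c_def scaleR_add_right)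
        then have "a + b = ((s + t) *\<^sub>R (x - c), (s + t) * \<delta>)"
          by (simp add: a(1) b(1) scaleR_diff_right scaleR_add_left distrib_right)
        then show ?thesis using AI[of "s + t" c] a(2) b(2) c by simp
      qed (use ab in auto)
    next
      fix a and c :: real assume a: "a \<in> A" and "0 \<le> c"
      show "c *\<^sub>R a \<in> A"
      proof (cases "c = 0 \<or> a = 0")
        case False
        then obtain s u where "a = (s *\<^sub>R (x - u), s * \<delta>)" "s > 0" "u \<in> H"
          using a by (auto simp: A_def zero_prod_def)
        then show ?thesis using AI[of "c * s" u] False \<open>0 \<le> c\<close> by (simp add: mult.assoc)
      qed (auto simp: A_def zero_prod_def)
    qed
    moreover have "\<forall>(w, d)\<in>A. d \<le> polar_seminorm U w"
      using \<delta>(2) sublinear_scaleR[OF p] sublinear_0[OF p] by (auto simp: A_def)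
    ultimately obtain f where f: "linear f" "\<And>z. f z \<le> polar_seminorm U z"
      and fA: "\<And>w d. (w, d) \<in> A \<Longrightarrow> d \<le> f w"
      using Mazur_Orlicz_cone[OF p] by metis
    have fu: "\<delta> \<le> f x - f u" if "u \<in> H" for u using fA[OF AI[of 1 u]] that linear_diff[OF f(1)] by simp
    have "f \<in> continuous_dual T" using below_seminorm_in_dual[OF dual f(1), of 1] f(2) by simp
    define V where "V = {z \<in> topspace T. f z \<in> {f x - \<delta> / 2<..}}"
    have "openin T V"
      unfolding V_def using continuous_dualD(2)[OF \<open>f \<in> _\<close>] by (rule openin_continuous_map_preimage) simp
    moreover have "x \<in> V" using \<delta>(1) by (simp add: V_def top)
    moreover have "z \<notin> seminorm_closure H" if "z \<in> V" for z
    proof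
      assume "z \<in> seminorm_closure H"
      then have "\<forall>\<delta>>0. \<exists>u\<in>H. polar_seminorm U (z - u) < \<delta>" by (simp add: seminorm_closure_def)
      then obtain u where u: "u \<in> H" "polar_seminorm U (z - u) < \<delta> / 2"
        using half_gt_zero[OF \<delta>(1)] by blast
      have "f z - f u \<le> polar_seminorm U (z - u)" using f(2)[of "z - u"] linear_diff[OF f(1)] by simp
      then show False using u(2) fu[OF u(1)] that by (simp add: V_def)
    qed
    ultimately show "\<exists>S. openin T S \<and> x \<in> S \<and> S \<subseteq> topspace T - seminorm_closure H"
      by (intro exI[of _ V]) (auto simp: top)
  qed
qed

end

section \<open>Sequences equivalent to the unit vector basis of \<open>\<ell>\<^sub>1\<close>\<close>

text \<open>On a set that looks like the positive face of the unit sphere of \<open>\<ell>\<^sub>1\<close>, the shift-like map below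
  moves the tail mass \<open>t\<close> of a point to \<open>h t\<close> one step further to the right, so every
  approximate fixed point sequence would have its mass escaping to infinity.\<close>

lemma l1_face_no_weak_AFPP:
  fixes \<tau> :: "'a::real_vector topology" and \<Phi> :: "nat set \<Rightarrow> 'a \<Rightarrow> real" and y :: "nat \<Rightarrow> 'a"
  assumes \<tau>: "locally_convex_topology \<tau>" and D: "convex D" and yD: "\<And>i. y i \<in> D"
    and dual: "\<And>B. \<Phi> B \<in> continuous_dual \<tau>"
    and \<Phi>y: "\<And>B i. \<Phi> B (y i) = of_bool (i \<in> B)"
    and add: "\<And>A B z. A \<inter> B = {} \<Longrightarrow> z \<in> D \<Longrightarrow> \<Phi> (A \<union> B) z = \<Phi> A z + \<Phi> B z"
    and nonneg: "\<And>B z. z \<in> D \<Longrightarrow> 0 \<le> \<Phi> B z"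
    and one: "\<And>z. z \<in> D \<Longrightarrow> \<Phi> UNIV z = 1"
    and tail: "\<And>z e. z \<in> D \<Longrightarrow> e > 0 \<Longrightarrow> \<exists>n. \<Phi> {n..} z < e"
  shows "\<not> weak_AFPP \<tau> D"
proof
  assume afpp: "weak_AFPP \<tau> D"
  have top: "topspace \<tau> = UNIV" by (rule locally_convex_topologyD[OF \<tau>])
  define t where "t n z = \<Phi> {n..} z" for n z
  have t0: "t 0 z = 1" if "z \<in> D" for z using one[OF that] by (simp add: t_def)
  have mono: "\<Phi> A z \<le> \<Phi> B z" if "A \<subseteq> B" "z \<in> D" for A B z
    using add[of A "B - A" z] nonneg[of z "B - A"] that by (simp add: Un_absorb1)
  have t_anti: "t n z \<le> t m z" if "m \<le> n" "z \<in> D" for m n z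
    unfolding t_def using that by (intro mono) auto
  have block: "\<Phi> {m..<n} z = t m z - t n z" if "m \<le> n" "z \<in> D" for m n z
  proof -
    have "{m..} = {m..<n} \<union> {n..}" "{m..<n} \<inter> {n..} = {}" using that by auto
    then show ?thesis using add[of "{m..<n}" "{n..}" z] that by (simp add: t_def)
  qed
  \<comment> \<open>Vanishing up to 1/4 leaves finitely many nonzero weights, so no series has to
    converge; the value 1 from 1/2 on restores a large tail to full mass; monotonicity makes the
    weights nonnegative.\<close>
  define h :: "real \<Rightarrow> real" where "h s = max 0 (min 1 (4 * s - 1))" for s
  have h: "h s = 1" if "s \<ge> 1 / 2" for s using that by (simp add: h_def)
  have h0: "h s = 0" if "s \<le> 1 / 4" for s using that by (simp add: h_def)
  have h_mono: "h s \<le> h s'" if "s \<le> s'" for s s' using that by (auto simp: h_def)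
  define w where "w i z = h (t i z) - h (t (Suc i) z)" for i z
  have w_ge0: "0 \<le> w i z" if "z \<in> D" for i z using h_mono[OF t_anti[of i "Suc i" z]] that by (simp add: w_def)
  define fN where "fN N z = (\<Sum>i<N. w i z *\<^sub>R y (Suc i))" for N z
  define N where "N z = (LEAST n. t n z < 1 / 4)" for z
  define f where "f z = fN (N z) z" for z
  have N: "t (N z) z < 1 / 4" if "z \<in> D" for z
    unfolding N_def by (rule LeastI_ex) (use tail[OF that, of "1 / 4"] in \<open>simp add: t_def\<close>)
  have w0: "w i z = 0" if "t n z < 1 / 4" "n \<le> i" "z \<in> D" for i n z
    using t_anti[of n i z] t_anti[of n "Suc i" z] that by (simp add: w_def h0)
  have f_eq: "f z = fN n z" if z: "z \<in> D" and n: "t n z < 1 / 4" for n z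
  proof -
    have "N z \<le> n" unfolding N_def using n by (rule Least_le)
    have "fN n z = (\<Sum>i<N z. w i z *\<^sub>R y (Suc i))"
      unfolding fN_def using w0[OF N[OF z] _ z] \<open>N z \<le> n\<close> by (intro sum.mono_neutral_right) auto
    then show ?thesis by (simp add: f_def fN_def)
  qed
  have fD: "f z \<in> D" if z: "z \<in> D" for z
    unfolding f_def fN_def
  proof (rule convex_sum)
    show "(\<Sum>i<N z. w i z) = 1"
      using N[OF z] t0[OF z] sum_lessThan_telescope'[of "\<lambda>i. h (t i z)" "N z"]
      by (simp add: w_def h h0)
  qed (use D yD w_ge0[OF z] in auto)
  \<comment> \<open>The weights from \<open>j\<close> on telescope down to a tail where
    \<open>h\<close> is 0. The index moves by one because \<open>w i\<close> is placed at
    \<open>y (Suc i)\<close>.\<close>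
  have tf: "t (Suc j) (f z) = h (t j z)" if z: "z \<in> D" for j z
  proof -
    define n where "n = max j (N z)"
    have n: "t n z < 1 / 4" "j \<le> n" using t_anti[of "N z" n z] N[OF z] z by (auto simp: n_def)
    have lin: "linear (\<Phi> {Suc j..})" by (rule continuous_dualD[OF dual])
    have "t (Suc j) (f z) = (\<Sum>i<n. w i z * of_bool (j \<le> i))"
      unfolding t_def f_eq[OF z n(1)] fN_def by (simp add: linear_sum[OF lin] linear_scale[OF lin] \<Phi>y)
    also have "\<dots> = (\<Sum>i\<in>{j..<n}. w i z)"
      by (intro sum.mono_neutral_cong_right) auto
    also have "\<dots> = h (t j z) - h (t n z)"
      using sum_Suc_diff'[OF n(2), of "\<lambda>i. - h (t i z)"] by (simp add: w_def)
    finally show ?thesis using n(1) by (simp add: h0)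
  qed
  have ft0: "t m (f z) = 0" if "z \<in> D" "m > N z" for m z
  proof -
    have "N z \<le> m - 1" using that(2) by simp
    then have "t (m - 1) z < 1 / 4" using t_anti[of "N z" "m - 1" z] N[OF that(1)] that by simp
    then show ?thesis using tf[OF that(1), of "m - 1"] that(2) by (simp add: h0)
  qed
  \<comment> \<open>The index \<open>N z\<close> may jump, but on the open set where the
    \<open>n\<close>-th tail is below 1/4 the map is the finite sum \<open>fN n\<close>, and these
    sets cover \<open>D\<close>.\<close>
  have "continuous_map (subtopology \<tau> D) \<tau> f"
  proof (rule pasting_lemma[where I = UNIV and T = "\<lambda>n. {z \<in> topspace (subtopology \<tau> D). t n z \<in> {..<1/4}}" and f = fN])
    have cont: "continuous_map (subtopology \<tau> D) euclideanreal (t n)" for n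
      unfolding t_def using continuous_dualD(2)[OF dual] by (rule continuous_map_from_subtopology)
    then show "openin (subtopology \<tau> D) {z \<in> topspace (subtopology \<tau> D). t n z \<in> {..<1/4}}" for n
      by (intro openin_continuous_map_preimage) auto
    have "continuous_on UNIV h" unfolding h_def by (intro continuous_intros)
    then have "continuous_map (subtopology \<tau> D) euclideanreal (h \<circ> t n)" for n
      by (intro continuous_map_compose[OF cont]) (simp add: continuous_map_iff_continuous2)
    then have "continuous_map (subtopology \<tau> D) euclideanreal (w n)" for n
      unfolding w_def by (intro continuous_map_diff) (simp_all add: comp_def)
    then have "continuous_map (subtopology \<tau> D) \<tau> (fN n)" for n
      unfolding fN_def
      by (intro continuous_map_vector_sum[OF \<tau>] continuous_map_vector_scaleR[OF \<tau>]) (simp_all add: top)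
    then show "continuous_map (subtopology (subtopology \<tau> D) {z \<in> topspace (subtopology \<tau> D). t n z \<in> {..<1/4}}) \<tau> (fN n)" for n
      by (rule continuous_map_from_subtopology)
  next
    show "fN i x = fN j x"
      if "x \<in> topspace (subtopology \<tau> D) \<inter> {z \<in> topspace (subtopology \<tau> D). t i z \<in> {..<1/4}} \<inter>
        {z \<in> topspace (subtopology \<tau> D). t j z \<in> {..<1/4}}" for i j x
      using that f_eq[of x i] f_eq[of x j] by (simp add: top)
    show "\<exists>j. j \<in> UNIV \<and> x \<in> {z \<in> topspace (subtopology \<tau> D). t j z \<in> {..<1/4}} \<and> f x = fN j x"
      if "x \<in> topspace (subtopology \<tau> D)" for x
      using that N[of x] by (intro exI[of _ "N x"]) (simp add: top f_def)
  qed
  then have "continuous_map (subtopology \<tau> D) (subtopology \<tau> D) f"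
    using fD by (auto simp: continuous_map_in_subtopology top)
  from afpp[unfolded weak_AFPP_def, rule_format, OF this]
  obtain z where z: "(\<forall>n. z n \<in> D) \<and> (\<forall>\<phi>\<in>continuous_dual \<tau>. (\<lambda>n. \<phi> (z n - f (z n))) \<longlonglongrightarrow> 0)" ..
  have zD: "z n \<in> D" for n using z by blast
  have lim: "(\<lambda>n. \<phi> (z n - f (z n))) \<longlonglongrightarrow> 0" if "\<phi> \<in> continuous_dual \<tau>" for \<phi> using z that by blast
  have lim\<Phi>: "(\<lambda>n. \<Phi> B (z n) - \<Phi> B (f (z n))) \<longlonglongrightarrow> 0" for B
    using lim[OF dual[of B]] linear_diff[OF continuous_dualD(1)[OF dual[of B]]] by simp
  \<comment> \<open>Once the \<open>p\<close>-th tail exceeds 1/2, the next tail of the image is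
    exactly 1, and an approximate fixed point has to follow.\<close>
  have t_lim: "(\<lambda>n. t p (z n)) \<longlonglongrightarrow> 1" for p
  proof (induction p)
    case 0
    then show ?case using t0[OF zD] by simp
  next
    case (Suc p)
    have "\<forall>\<^sub>F n in sequentially. t p (z n) > 1 / 2"
      using Suc by (rule order_tendstoD) simp
    then have "\<forall>\<^sub>F n in sequentially. t (Suc p) (z n) - t (Suc p) (f (z n)) = t (Suc p) (z n) - 1"
      by eventually_elim (simp add: tf[OF zD] h)
    then have "(\<lambda>n. t (Suc p) (z n) - 1) \<longlonglongrightarrow> 0"
      using lim\<Phi>[of "{Suc p..}"] unfolding t_def by (rule Lim_transform_eventually[rotated])
    then show ?case using tendsto_add[of "\<lambda>n. t (Suc p) (z n) - 1" 0 sequentially "\<lambda>_. 1" 1] by simp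
  qed
  \<comment> \<open>The hump: with \<open>m\<close> the first index where the tail of
    \<open>z n\<close> is below 1/2, the point has mass above 7/8 - 1/2 = 3/8 in
    \<open>{p..<m}\<close>, while its image has all its mass in \<open>{m..<q}\<close>.\<close>
  have "\<exists>n m q. p \<le> n \<and> p \<le> m \<and> m < q \<and> 7 / 8 < t p (z n) \<and> t m (z n) < 1 / 2 \<and>
    t m (f (z n)) = 1 \<and> t q (f (z n)) = 0" for p
  proof -
    have "\<forall>\<^sub>F n in sequentially. t p (z n) > 7 / 8" using t_lim by (rule order_tendstoD) simp
    then obtain n where n: "p \<le> n" "7 / 8 < t p (z n)"
      unfolding eventually_sequentially by (metis nle_le)
    define m where "m = (LEAST m. t m (z n) < 1 / 2)"
    have m: "t m (z n) < 1 / 2"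
      unfolding m_def by (rule LeastI[of _ "N (z n)"]) (use N[OF zD[of n]] in simp)
    have "p \<le> m" using m n(2) t_anti[OF _ zD, of m p n] by (cases "m \<le> p") auto
    have "m \<noteq> 0" using m t0[OF zD[of n]] by (intro notI) simp
    then obtain m' where m': "m = Suc m'" using not0_implies_Suc by blast
    have "\<not> t m' (z n) < 1 / 2" using not_less_Least[of m'] m' unfolding m_def by force
    then have "t m (f (z n)) = 1" by (simp add: m' tf[OF zD] h)
    moreover have "t (Suc (max m (N (z n)))) (f (z n)) = 0" by (intro ft0 zD) simp
    ultimately show ?thesis using n m \<open>p \<le> m\<close> by (meson less_Suc_eq_le max.cobounded1)
  qed
  then obtain n m q where nmq: "\<And>p. p \<le> n p" "\<And>p. p \<le> m p" "\<And>p. m p < q p"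
    "\<And>p. 7 / 8 < t p (z (n p))" "\<And>p. t (m p) (z (n p)) < 1 / 2"
    "\<And>p. t (m p) (f (z (n p))) = 1" "\<And>p. t (q p) (f (z (n p))) = 0" by metis
  define P where "P = rec_nat 0 (\<lambda>_. q)"
  have P_Suc: "P (Suc k) = q (P k)" for k by (simp add: P_def)
  have P: "strict_mono P"
    using nmq(2,3) by (auto simp: strict_mono_Suc_iff P_Suc intro: le_less_trans)
  \<comment> \<open>Stage \<open>Suc k\<close> starts at \<open>q (P k)\<close>, beyond the image
    mass of stage \<open>k\<close>. So \<open>B\<close> contains every hump and misses the mass of
    every image, and the single functional \<open>\<Phi> B\<close> sees the gap at all
    stages.\<close>
  define B where "B = (\<Union>k. {P k..<m (P k)})"
  have gap: "3 / 8 < \<Phi> B (z (n (P k))) - \<Phi> B (f (z (n (P k))))" for k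
  proof -
    let ?z = "z (n (P k))"
    have "3 / 8 < t (P k) ?z - t (m (P k)) ?z" using nmq(4,5)[of "P k"] by simp
    also have "\<dots> = \<Phi> {P k..<m (P k)} ?z" using block[OF nmq(2) zD] by simp
    also have "\<dots> \<le> \<Phi> B ?z" by (intro mono zD) (auto simp: B_def)
    finally have 1: "3 / 8 < \<Phi> B ?z" .
    have "B \<subseteq> {0..<m (P k)} \<union> {q (P k)..}"
    proof
      fix i assume "i \<in> B"
      then obtain j where j: "P j \<le> i" "i < m (P j)" by (auto simp: B_def)
      consider "j < k" | "j = k" | "k < j" by linarith
      then show "i \<in> {0..<m (P k)} \<union> {q (P k)..}"
      proof cases
        case 1
        then have "q (P j) \<le> P k" using P by (metis P_Suc Suc_leI strict_mono_less_eq)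
        then show ?thesis using j(2) nmq(3)[of "P j"] nmq(2)[of "P k"] by auto
      next
        case 3
        then have "q (P k) \<le> P j" using P by (metis P_Suc Suc_leI strict_mono_less_eq)
        then show ?thesis using j(1) by auto
      qed (use j in auto)
    qed
    then have "\<Phi> B (f ?z) \<le> \<Phi> ({0..<m (P k)} \<union> {q (P k)..}) (f ?z)"
      by (intro mono fD zD)
    also have "\<dots> = \<Phi> {0..<m (P k)} (f ?z) + t (q (P k)) (f ?z)"
      unfolding t_def using nmq(3)[of "P k"] by (intro add fD zD) auto
    also have "\<dots> = 0" using block[of 0 "m (P k)" "f ?z"] nmq(6,7)[of "P k"] t0 fD zD by simp
    finally show ?thesis using 1 by simp
  qed
  obtain M where M: "\<And>n. n \<ge> M \<Longrightarrow> norm (\<Phi> B (z n) - \<Phi> B (f (z n)) - 0) < 3 / 8"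
    using LIMSEQ_D[OF lim\<Phi>[of B], of "3 / 8"] by auto
  have "M \<le> P M" using seq_suble[OF P] .
  also have "P M \<le> n (P M)" by (rule nmq)
  finally show False using M[of "n (P M)"] gap[of M] by simp
qed

text \<open>Two functionals chosen by the signs of the coefficients bound (b - a) times the sum of
  the \<open>\<bar>c i\<bar>\<close> by twice the seminorm of the combination. Their difference is
  used since only the gap between \<open>a\<close> and \<open>b\<close> is known, not their position
  relative to 0; hence the factor 2.\<close>

lemma l1_functional:
  fixes y :: "nat \<Rightarrow> 'a::real_vector"
  assumes U: "absorbing U" and ab: "a < b"
    and indep: "\<And>B. \<exists>\<phi>\<in>real_polar U. \<forall>i. if i \<in> B then \<phi> (y i) \<le> a else b \<le> \<phi> (y i)"
    and \<epsilon>: "\<And>i. \<bar>\<epsilon> i\<bar> \<le> 1"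
  shows "\<exists>f. linear f \<and> (\<forall>z. f z \<le> 2 / (b - a) * polar_seminorm U z) \<and> (\<forall>i. f (y i) = \<epsilon> i)"
proof -
  note p = sublinear_polar_seminorm[OF U]
  let ?P = "\<lambda>z. 2 / (b - a) * polar_seminorm U z"
  have P: "sublinear ?P"
    unfolding sublinear_def
  proof (intro conjI allI impI)
    have ge0: "0 \<le> 2 / (b - a)" using ab by simp
    show "?P (x + z) \<le> ?P x + ?P z" for x z
      using mult_left_mono[OF sublinearD(1)[OF p] ge0] by (simp add: distrib_left)
    show "?P (c *\<^sub>R x) \<le> c * ?P x" if "c > 0" for c x
      using sublinear_scaleR[OF p, of c x] that by (simp add: ac_simps)
  qed
  have key: "(\<Sum>i<n. c i * \<epsilon> i) \<le> ?P (\<Sum>i<n. c i *\<^sub>R y i)" for c n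
  proof -
    let ?z = "\<Sum>i<n. c i *\<^sub>R y i"
    obtain \<phi> where \<phi>: "\<phi> \<in> real_polar U" "\<And>i. if c i \<le> 0 then \<phi> (y i) \<le> a else b \<le> \<phi> (y i)"
      using indep[of "{i. c i \<le> 0}"] by auto
    obtain \<psi> where \<psi>: "\<psi> \<in> real_polar U" "\<And>i. if c i > 0 then \<psi> (y i) \<le> a else b \<le> \<psi> (y i)"
      using indep[of "{i. c i > 0}"] by auto
    have lin: "linear \<phi>" "linear \<psi>" using \<phi>(1) \<psi>(1) by (auto simp: real_polar_def)
    have "(b - a) * (\<Sum>i<n. c i * \<epsilon> i) = (\<Sum>i<n. (c i * \<epsilon> i) * (b - a))"
      by (simp add: sum_distrib_left mult.commute)
    also have "\<dots> \<le> (\<Sum>i<n. \<bar>c i\<bar> * (b - a))"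
    proof (intro sum_mono mult_right_mono)
      show "c i * \<epsilon> i \<le> \<bar>c i\<bar>" for i
        using abs_ge_self[of "c i * \<epsilon> i"] mult_left_mono[OF \<epsilon>, of "\<bar>c i\<bar>" i] by (simp add: abs_mult)
    qed (use ab in simp)
    also have "\<dots> \<le> (\<Sum>i<n. c i * (\<phi> (y i) - \<psi> (y i)))"
    proof (rule sum_mono)
      fix i
      show "\<bar>c i\<bar> * (b - a) \<le> c i * (\<phi> (y i) - \<psi> (y i))"
      proof (cases "c i > 0")
        case True
        then have "b - a \<le> \<phi> (y i) - \<psi> (y i)" using \<phi>(2)[of i] \<psi>(2)[of i] by simp
        then show ?thesis using True by simp
      next
        case False
        then have "b - a \<le> \<psi> (y i) - \<phi> (y i)" using \<phi>(2)[of i] \<psi>(2)[of i] by simp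
        then have "- c i * (b - a) \<le> - c i * (\<psi> (y i) - \<phi> (y i))" using False by (intro mult_left_mono) auto
        then show ?thesis using False by (simp add: algebra_simps)
      qed
    qed
    also have "\<dots> = \<phi> ?z - \<psi> ?z"
      using lin by (simp add: linear_sum linear_scale right_diff_distrib sum_subtractf)
    also have "\<dots> \<le> 2 * polar_seminorm U ?z"
      using polar_le_seminorm[OF U \<phi>(1), of ?z] polar_le_seminorm[OF U uminus_in_real_polar[OF \<psi>(1)], of ?z] by simp
    finally show ?thesis using ab by (simp add: field_simps)
  qed
  define g where "g i = (y i, \<epsilon> i)" for i
  \<comment> \<open>The graph of the prescription on the span of the \<open>y i\<close>. It is a
    subspace, so the demands at \<open>y i\<close> and \<open>- y i\<close> together give
    equality.\<close>
  define A where "A = {(\<Sum>i<n. c i *\<^sub>R g i) | n c. True}"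
  have AI: "(\<Sum>i<n. c i *\<^sub>R g i) \<in> A" for n c unfolding A_def by blast
  have "convex_cone A"
    unfolding convex_cone_iff
  proof (intro conjI ballI allI impI)
    show "0 \<in> A" using AI[where n = 0] by simp
  next
    fix u v assume "u \<in> A" "v \<in> A"
    then obtain n c m d where uv: "u = (\<Sum>i<n. c i *\<^sub>R g i)" "v = (\<Sum>i<m. d i *\<^sub>R g i)"
      unfolding A_def by blast
    define N where "N = max n m"
    have ext: "(\<Sum>i<k. e i *\<^sub>R g i) = (\<Sum>i<N. (if i < k then e i else 0) *\<^sub>R g i)" if "k \<le> N" for k e
      using that by (intro sum.mono_neutral_cong_left) auto
    have "u + v = (\<Sum>i<N. ((if i < n then c i else 0) + (if i < m then d i else 0)) *\<^sub>R g i)"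
      unfolding uv using ext[of n c] ext[of m d] by (simp add: N_def scaleR_add_left sum.distrib)
    then show "u + v \<in> A" using AI by metis
  next
    fix u and s :: real assume "u \<in> A"
    then obtain n c where "u = (\<Sum>i<n. c i *\<^sub>R g i)" unfolding A_def by blast
    then have "s *\<^sub>R u = (\<Sum>i<n. (s * c i) *\<^sub>R g i)" by (simp add: scaleR_sum_right)
    then show "s *\<^sub>R u \<in> A" using AI by metis
  qed
  moreover have "\<forall>(w, d)\<in>A. d \<le> ?P w"
  proof
    fix x assume "x \<in> A"
    then obtain n c where x: "x = (\<Sum>i<n. c i *\<^sub>R g i)" unfolding A_def by blast
    have "fst x = (\<Sum>i<n. c i *\<^sub>R y i)" "snd x = (\<Sum>i<n. c i * \<epsilon> i)"
      by (simp_all add: x fst_sum snd_sum g_def)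
    then show "case x of (w, d) \<Rightarrow> d \<le> ?P w" using key[where n = n and c = c] by (simp add: case_prod_beta)
  qed
  ultimately obtain f where f: "linear f" "\<And>z. f z \<le> ?P z" and fA: "\<And>w d. (w, d) \<in> A \<Longrightarrow> d \<le> f w"
    using Mazur_Orlicz_cone[OF P] by metis
  have "f (y i) = \<epsilon> i" for i
  proof -
    have "s *\<^sub>R g i \<in> A" for s
    proof -
      have "(\<Sum>j<Suc i. (if j = i then s else 0) *\<^sub>R g j) = (\<Sum>j<Suc i. if j = i then s *\<^sub>R g j else 0)"
        by (intro sum.cong) auto
      also have "\<dots> = s *\<^sub>R g i" by (simp add: sum.delta)
      finally show ?thesis using AI by metis
    qed
    from fA[of "1 *\<^sub>R y i" "1 * \<epsilon> i"] fA[of "(- 1) *\<^sub>R y i" "(- 1) * \<epsilon> i"] this[of 1] this[of "- 1"]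
    show ?thesis by (simp add: g_def linear_neg[OF f(1)])
  qed
  then show ?thesis using f by blast
qed

text \<open>Points of \<open>D\<close> are approximated from the hull in one seminorm that dominates
  all \<open>\<Phi> B\<close> with the same constant. So linear inequalities pass from the
  \<open>y i\<close> to \<open>D\<close>, and tails become small because points of the hull have
  finite support.\<close>

lemma l1_sequence_no_weak_AFPP:
  fixes y :: "nat \<Rightarrow> 'a::real_vector"
  assumes \<tau>: "locally_convex_topology \<tau>" and C: "closedin \<tau> C" "convex C"
    and U: "absorbing U" and dual: "real_polar U \<subseteq> continuous_dual \<tau>"
    and yC: "\<And>i. y i \<in> C" and ab: "a < b"
    and indep: "\<And>B. \<exists>\<phi>\<in>real_polar U. \<forall>i. if i \<in> B then \<phi> (y i) \<le> a else b \<le> \<phi> (y i)"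
  shows "\<exists>D. D \<noteq> {} \<and> closedin \<tau> D \<and> convex D \<and> D \<subseteq> C \<and> \<not> weak_AFPP \<tau> D"
proof -
  let ?p = "polar_seminorm U"
  define M where "M = 2 / (b - a)"
  have "M > 0" using ab by (simp add: M_def)
  have "\<forall>B. \<exists>f. linear f \<and> (\<forall>z. f z \<le> M * ?p z) \<and> (\<forall>i. f (y i) = of_bool (i \<in> B))"
    unfolding M_def using l1_functional[OF U ab indep] by auto
  from choice[OF this] obtain \<Phi> where \<Phi>: "\<forall>B. linear (\<Phi> B) \<and> (\<forall>z. \<Phi> B z \<le> M * ?p z) \<and> (\<forall>i. \<Phi> B (y i) = of_bool (i \<in> B))" ..
  have lin: "linear (\<Phi> B)" and le: "\<Phi> B z \<le> M * ?p z" and \<Phi>y: "\<Phi> B (y i) = of_bool (i \<in> B)" for B z i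
    using \<Phi> by auto
  note abs_le = below_seminorm_abs_le[OF U lin le]
  define H where "H = convex hull (range y)"
  define D where "D = C \<inter> seminorm_closure U H"
  have yH: "y i \<in> H" for i unfolding H_def by (intro hull_inc) simp
  then have yD: "y i \<in> D" for i using subset_seminorm_closure[OF U] yC by (auto simp: D_def)
  have D: "convex D" unfolding D_def H_def by (intro convex_Int C convex_seminorm_closure[OF U]) simp
  have Dcl: "closedin \<tau> D"
    unfolding D_def H_def by (intro closedin_Int C closedin_seminorm_closure[OF U \<tau> dual]) simp
  have approx: "\<exists>u\<in>H. ?p (z - u) < \<delta>" if "z \<in> D" "\<delta> > 0" for z \<delta>
    using that by (auto simp: D_def seminorm_closure_def[OF U])
  have transfer: "\<psi> z \<le> c"
    if \<psi>: "linear \<psi>" "\<And>z. \<psi> z \<le> M' * ?p z" "M' > 0" "\<And>i. \<psi> (y i) \<le> c" and z: "z \<in> D" for \<psi> M' c z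
  proof (rule field_le_epsilon)
    fix e :: real assume "e > 0"
    then obtain u where u: "u \<in> H" "?p (z - u) < e / M'" using approx[OF z, of "e / M'"] \<psi>(3) by auto
    have "convex {u. \<psi> u \<le> c}"
      by (rule convexI) (simp add: linear_add[OF \<psi>(1)] linear_scale[OF \<psi>(1)] convex_bound_le)
    then have "H \<subseteq> {u. \<psi> u \<le> c}" unfolding H_def using \<psi>(4) by (intro hull_minimal) auto
    then have "\<psi> u \<le> c" using u(1) by blast
    moreover have "\<psi> z = \<psi> u + \<psi> (z - u)" by (simp add: linear_diff[OF \<psi>(1)])
    moreover have "\<psi> (z - u) \<le> e"
      using \<psi>(2)[of "z - u"] u(2) \<psi>(3) by (simp add: field_simps)
    ultimately show "\<psi> z \<le> c + e" by linarith
  qed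
  have "\<not> weak_AFPP \<tau> D"
  proof (rule l1_face_no_weak_AFPP[OF \<tau> D yD, where \<Phi> = \<Phi>])
    show "\<Phi> B \<in> continuous_dual \<tau>" for B by (rule below_seminorm_in_dual[OF U dual lin le \<open>M > 0\<close>])
    show "\<Phi> B (y i) = of_bool (i \<in> B)" for B i by (rule \<Phi>y)
    show "\<Phi> (A \<union> B) z = \<Phi> A z + \<Phi> B z" if AB: "A \<inter> B = {}" and z: "z \<in> D" for A B z
    proof -
      have *: "\<Phi> (A \<union> B) (y i) = \<Phi> A (y i) + \<Phi> B (y i)" for i using AB by (auto simp: \<Phi>y)
      \<comment> \<open>Equality is split into two inequalities, the form that
        \<open>transfer\<close> handles; \<open>3 * M\<close> bounds the combination of three
        functionals.\<close>
      have 1: "\<Phi> (A \<union> B) z - \<Phi> A z - \<Phi> B z \<le> 0"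
      proof (rule transfer[of "\<lambda>z. \<Phi> (A \<union> B) z - \<Phi> A z - \<Phi> B z" "3 * M"])
        show "linear (\<lambda>z. \<Phi> (A \<union> B) z - \<Phi> A z - \<Phi> B z)" by (intro linear_compose_sub lin)
        show "\<Phi> (A \<union> B) z - \<Phi> A z - \<Phi> B z \<le> 3 * M * ?p z" for z
          using abs_le[of "A \<union> B" z] abs_le[of A z] abs_le[of B z] by (simp add: abs_le_iff)
      qed (use z * \<open>M > 0\<close> in auto)
      have 2: "\<Phi> A z + \<Phi> B z - \<Phi> (A \<union> B) z \<le> 0"
      proof (rule transfer[of "\<lambda>z. \<Phi> A z + \<Phi> B z - \<Phi> (A \<union> B) z" "3 * M"])
        show "linear (\<lambda>z. \<Phi> A z + \<Phi> B z - \<Phi> (A \<union> B) z)" by (intro linear_compose_sub linear_compose_add lin)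
        show "\<Phi> A z + \<Phi> B z - \<Phi> (A \<union> B) z \<le> 3 * M * ?p z" for z
          using abs_le[of "A \<union> B" z] abs_le[of A z] abs_le[of B z] by (simp add: abs_le_iff)
      qed (use z * \<open>M > 0\<close> in auto)
      from 1 2 show ?thesis by simp
    qed
    have neg: "- \<Phi> B z \<le> M * ?p z" for B z using abs_le[of B z] by (simp add: abs_le_iff)
    show "0 \<le> \<Phi> B z" if z: "z \<in> D" for B z
      using transfer[OF linear_compose_neg[OF lin[of B]] neg[of B] \<open>M > 0\<close> _ z, of 0] by (simp add: \<Phi>y)
    show "\<Phi> UNIV z = 1" if z: "z \<in> D" for z
      using transfer[OF linear_compose_neg[OF lin[of UNIV]] neg[of UNIV] \<open>M > 0\<close> _ z, of "- 1"]
        transfer[OF lin[of UNIV] le[of UNIV] \<open>M > 0\<close> _ z, of 1] by (simp add: \<Phi>y)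
    show "\<exists>n. \<Phi> {n..} z < e" if z: "z \<in> D" and "e > 0" for z e
    proof -
      obtain u where u: "u \<in> H" "?p (z - u) < e / M" using approx[OF z, of "e / M"] \<open>e > 0\<close> \<open>M > 0\<close> by auto
      have "convex {u. \<exists>n. \<forall>k\<ge>n. \<Phi> {k..} u = 0}"
      proof (rule convexI, elim CollectE exE)
        fix u v n m and s t :: real
        assume "\<forall>k\<ge>n. \<Phi> {k..} u = 0" "\<forall>k\<ge>m. \<Phi> {k..} v = 0"
        then show "s *\<^sub>R u + t *\<^sub>R v \<in> {u. \<exists>n. \<forall>k\<ge>n. \<Phi> {k..} u = 0}"
          by (intro CollectI exI[of _ "max n m"]) (simp add: linear_add[OF lin] linear_scale[OF lin])
      qed
      moreover have "range y \<subseteq> {u. \<exists>n. \<forall>k\<ge>n. \<Phi> {k..} u = 0}"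
      proof (intro image_subsetI CollectI)
        show "\<exists>n. \<forall>k\<ge>n. \<Phi> {k..} (y i) = 0" for i by (intro exI[of _ "Suc i"]) (simp add: \<Phi>y)
      qed
      ultimately have "H \<subseteq> {u. \<exists>n. \<forall>k\<ge>n. \<Phi> {k..} u = 0}" unfolding H_def by (intro hull_minimal)
      then obtain n where "\<Phi> {n..} u = 0" using u(1) by blast
      then have "\<Phi> {n..} z = \<Phi> {n..} (z - u)" by (simp add: linear_diff[OF lin])
      also have "\<dots> \<le> M * ?p (z - u)" by (rule le)
      also have "\<dots> < e" using u(2) \<open>M > 0\<close> by (simp add: field_simps)
      finally show ?thesis by blast
    qed
  qed
  then show ?thesis using D Dcl yD by (intro exI[of _ D]) (auto simp: D_def)
qed

section \<open>The weak approximate fixed point property\<close>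

lemma weak_AFPP_of_weakly_Cauchy_subsequences:
  fixes \<tau> :: "'a::real_vector topology" and K :: "nat \<Rightarrow> ('a \<Rightarrow> real) set"
  assumes \<tau>: "locally_convex_topology \<tau>"
    and K: "\<And>m. compact (K m)" "incseq K" "K 0 \<noteq> {}" "continuous_dual \<tau> = (\<Union>m. K m)"
    and D: "D \<noteq> {}" "convex D" and bdd: "\<And>\<phi>. \<phi> \<in> continuous_dual \<tau> \<Longrightarrow> bounded (\<phi> ` D)"
    and seq: "\<And>x :: nat \<Rightarrow> 'a. (\<And>n. x n \<in> D) \<Longrightarrow> \<exists>r :: nat \<Rightarrow> nat. strict_mono r \<and> weakly_Cauchy \<tau> (x \<circ> r)"
  shows "weak_AFPP \<tau> D"
  unfolding weak_AFPP_def
proof (intro allI impI)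
  fix f assume f: "continuous_map (subtopology \<tau> D) (subtopology \<tau> D) f"
  have fD: "f x \<in> D" if "x \<in> D" for x
    using continuous_map_image_subset_topspace[OF f] that locally_convex_topologyD(1)[OF \<tau>] by auto
  define G where "G x \<phi> = (\<phi> (x - f x) :: real)" for x and \<phi> :: "'a \<Rightarrow> real"
  have cont: "continuous_on UNIV (G x)" for x by (simp add: G_def)
  have "pointwise_clusters_0 G (\<Union>m. K m) D"
    unfolding pointwise_clusters_0_def
  proof (intro allI impI, elim conjE)
    fix F and e :: real assume F: "finite F" "F \<subseteq> (\<Union>m. K m)" and "e > 0"
    have F': "F \<subseteq> continuous_dual \<tau>" using F(2) K(4) by simp
    obtain x where "x \<in> D" "\<And>\<phi>. \<phi> \<in> F \<Longrightarrow> \<bar>\<phi> (x - f x)\<bar> < e"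
    proof (rule approximate_weak_fixed_point[OF \<tau> D f F(1) F' _ \<open>e > 0\<close>])
      show "bounded (\<phi> ` D)" if "\<phi> \<in> F" for \<phi> using bdd F' that by blast
    qed blast
    then show "\<exists>i\<in>D. \<forall>t\<in>F. \<bar>G i t\<bar> < e" by (auto simp: G_def)
  qed
  \<comment> \<open>With every set equal to \<open>D\<close>, fan tightness gives countable
    tightness.\<close>
  from countable_fan_tightness[OF K(1,2,3) cont, where M = "\<lambda>_. D", OF this]
  obtain Fs where "(\<forall>k. finite (Fs k)) \<and> (\<forall>k :: nat. Fs k \<subseteq> D) \<and>
    (\<forall>j. pointwise_clusters_0 G (\<Union>m. K m) (\<Union>k\<in>{j..}. Fs k))" ..
  then have Fs: "\<And>k. finite (Fs k)" "\<And>k. Fs k \<subseteq> D"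
    "\<And>j. pointwise_clusters_0 G (\<Union>m. K m) (\<Union>k\<in>{j..}. Fs k)" by blast+
  define A where "A = (\<Union>k. Fs k)"
  have A: "countable A" "A \<subseteq> D" "pointwise_clusters_0 G (\<Union>m. K m) A"
    using Fs(1,2) Fs(3)[of 0] by (auto simp: A_def uncountable_infinite intro: countable_finite)
  have "A \<noteq> {}" using pointwise_clusters_0D[OF A(3), of "{}" 1] by auto
  define x where "x = from_nat_into A"
  have x: "range x = A" unfolding x_def using \<open>A \<noteq> {}\<close> A(1) by (rule range_from_nat_into)
  then have xD: "x n \<in> D" for n using A(2) by blast
  obtain \<nu> :: "nat \<Rightarrow> nat" where \<nu>: "\<And>\<phi>. \<phi> \<in> (\<Union>m. K m) \<Longrightarrow> (\<lambda>k. G (x (\<nu> k)) \<phi>) \<longlonglongrightarrow> 0"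
  proof (rule pointwise_cluster_point_is_limit[OF K(1,2,3), of "\<lambda>n. G (x n)"])
    show "continuous_on UNIV (G (x n))" for n by (rule cont)
    show "pointwise_clusters_0 (\<lambda>n. G (x n)) (\<Union>m. K m) UNIV"
      using A(3) unfolding pointwise_clusters_0_def x[symmetric] by simp
    fix s :: "nat \<Rightarrow> nat" assume "strict_mono s"
    \<comment> \<open>As \<open>f\<close> need not be weakly continuous, the images need a second
      extraction; they stay in \<open>D\<close>, so the hypothesis applies again.\<close>
    obtain r1 where r1: "strict_mono r1" "weakly_Cauchy \<tau> (x \<circ> s \<circ> r1)"
      using seq[of "x \<circ> s"] xD by (auto simp: comp_assoc)
    obtain r2 where r2: "strict_mono r2" "weakly_Cauchy \<tau> (f \<circ> x \<circ> s \<circ> r1 \<circ> r2)"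
      using seq[of "f \<circ> x \<circ> s \<circ> r1"] xD fD by auto
    show "\<exists>r. strict_mono r \<and> (\<forall>\<phi>\<in>\<Union>m. K m. Cauchy (\<lambda>k. G (x (s (r k))) \<phi>))"
    proof (intro exI[of _ "r1 \<circ> r2"] conjI ballI)
      show "strict_mono (r1 \<circ> r2)" using r1(1) r2(1) by (rule strict_mono_o)
      fix \<phi> assume "\<phi> \<in> (\<Union>m. K m)"
      then have \<phi>: "\<phi> \<in> continuous_dual \<tau>" using K(4) by simp
      have "Cauchy (\<lambda>n. \<phi> ((x \<circ> s \<circ> r1) n))" using r1(2) \<phi> unfolding weakly_Cauchy_def by blast
      from Cauchy_subseq_Cauchy[OF this r2(1)]
      have 1: "convergent (\<lambda>k. \<phi> (x (s (r1 (r2 k)))))" by (simp add: comp_def Cauchy_convergent_iff)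
      have "Cauchy (\<lambda>n. \<phi> ((f \<circ> x \<circ> s \<circ> r1 \<circ> r2) n))" using r2(2) \<phi> unfolding weakly_Cauchy_def by blast
      then have 2: "convergent (\<lambda>k. \<phi> (f (x (s (r1 (r2 k))))))" by (simp add: comp_def Cauchy_convergent_iff)
      show "Cauchy (\<lambda>k. G (x (s ((r1 \<circ> r2) k))) \<phi>)"
        using convergent_diff[OF 1 2] linear_diff[OF continuous_dualD(1)[OF \<phi>]]
        by (simp add: G_def Cauchy_convergent_iff)
    qed
  qed blast
  show "\<exists>x. (\<forall>n. x n \<in> D) \<and> (\<forall>\<phi>\<in>continuous_dual \<tau>. (\<lambda>n. \<phi> (x n - f (x n))) \<longlonglongrightarrow> 0)"
    using \<nu> xD K(4) by (intro exI[of _ "x \<circ> \<nu>"]) (simp add: G_def)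
qed

theorem theorem4p3:
  fixes \<tau> :: "'a::real_vector topology" and C :: "'a set"
  assumes "locally_convex_topology \<tau>" and "Hausdorff_space \<tau>"
    and "\<exists>\<rho> :: 'a topology. locally_convex_topology \<rho> \<and> metrizable_space \<rho> \<and>
           continuous_dual \<rho> = continuous_dual \<tau>"
    and "C \<noteq> {}" and "closedin \<tau> C" and "convex C" and "tvs_bounded \<tau> C"
  shows "(\<forall>D. D \<noteq> {} \<and> closedin \<tau> D \<and> convex D \<and> D \<subseteq> C \<longrightarrow> weak_AFPP \<tau> D) \<longleftrightarrow>
         (\<forall>x :: nat \<Rightarrow> 'a. (\<forall>n. x n \<in> C) \<longrightarrow>
            (\<exists>r :: nat \<Rightarrow> nat. strict_mono r \<and> weakly_Cauchy \<tau> (x \<circ> r)))"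
proof -
  note \<tau> = assms(1)
  obtain \<rho> :: "'a topology" where \<rho>: "locally_convex_topology \<rho>" "metrizable_space \<rho>"
    and dual\<rho>: "continuous_dual \<rho> = continuous_dual \<tau>" using assms(3) by blast
  obtain U where U: "\<And>m. absorbing (U m)" and inc: "incseq (\<lambda>m. real_polar (U m))"
    and dual: "continuous_dual \<tau> = (\<Union>m. real_polar (U m))"
    using metrizable_dual_exhaustion[OF \<rho>] unfolding dual\<rho> by blast
  have bdd: "bounded (\<phi> ` C)" if "\<phi> \<in> continuous_dual \<tau>" for \<phi>
    using continuous_dual_bounded[OF \<tau> assms(7) that] .
  show ?thesis
  proof
    assume seq: "\<forall>x :: nat \<Rightarrow> 'a. (\<forall>n. x n \<in> C) \<longrightarrow>
      (\<exists>r :: nat \<Rightarrow> nat. strict_mono r \<and> weakly_Cauchy \<tau> (x \<circ> r))"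
    show "\<forall>D. D \<noteq> {} \<and> closedin \<tau> D \<and> convex D \<and> D \<subseteq> C \<longrightarrow> weak_AFPP \<tau> D"
    proof (intro allI impI, elim conjE)
      fix D assume D: "D \<noteq> {}" "convex D" "D \<subseteq> C"
      show "weak_AFPP \<tau> D"
      proof (rule weak_AFPP_of_weakly_Cauchy_subsequences[OF \<tau> _ inc _ dual D(1,2)])
        show "compact (real_polar (U m))" for m by (rule compact_real_polar[OF U])
        show "real_polar (U 0) \<noteq> {}" using zero_in_real_polar by blast
        show "bounded (\<phi> ` D)" if "\<phi> \<in> continuous_dual \<tau>" for \<phi>
          using bounded_subset[OF bdd[OF that] image_mono[OF D(3)]] .
        show "\<exists>r :: nat \<Rightarrow> nat. strict_mono r \<and> weakly_Cauchy \<tau> (x \<circ> r)" if "\<And>n. x n \<in> D" for x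
          using seq that D(3) by blast
      qed
    qed
  next
    assume afpp: "\<forall>D. D \<noteq> {} \<and> closedin \<tau> D \<and> convex D \<and> D \<subseteq> C \<longrightarrow> weak_AFPP \<tau> D"
    show "\<forall>x :: nat \<Rightarrow> 'a. (\<forall>n. x n \<in> C) \<longrightarrow>
      (\<exists>r :: nat \<Rightarrow> nat. strict_mono r \<and> weakly_Cauchy \<tau> (x \<circ> r))"
    proof (intro allI impI, rule ccontr)
      fix x :: "nat \<Rightarrow> 'a"
      assume x: "\<forall>n. x n \<in> C" and no: "\<nexists>r :: nat \<Rightarrow> nat. strict_mono r \<and> weakly_Cauchy \<tau> (x \<circ> r)"
      \<comment> \<open>The sequence is read as the evaluations at \<open>x n\<close> on the dual,
        which are continuous on each compact polar.\<close>
      obtain m a b and \<nu> :: "nat \<Rightarrow> nat" where ab: "a < b"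
        and indep: "\<And>B. \<exists>\<phi>\<in>real_polar (U m). \<forall>i. if i \<in> B then \<phi> (x (\<nu> i)) \<le> a else b \<le> \<phi> (x (\<nu> i))"
      proof (rule Rosenthal_dichotomy[of "\<lambda>m. real_polar (U m)" "\<lambda>n \<phi>. \<phi> (x n)"])
        show "compact (real_polar (U m))" for m by (rule compact_real_polar[OF U])
        show "continuous_on UNIV (\<lambda>\<phi>. \<phi> (x n))" for n by simp
        show "bounded (range (\<lambda>n. \<phi> (x n)))" if "\<phi> \<in> (\<Union>m. real_polar (U m))" for \<phi>
          by (rule bounded_subset[OF bdd]) (use that dual x in auto)
        show "\<exists>\<phi>\<in>\<Union>m. real_polar (U m). \<not> Cauchy (\<lambda>k. \<phi> (x (r k)))" if "strict_mono r" for r :: "nat \<Rightarrow> nat"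
          using no that unfolding weakly_Cauchy_def dual by (auto simp: comp_def)
      qed blast
      have "real_polar (U m) \<subseteq> continuous_dual \<tau>" using dual by blast
      from l1_sequence_no_weak_AFPP[OF \<tau> assms(5,6) U this _ ab indep] x afpp
      show False by blast
    qed
  qed
qed

end
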